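(* Let $G$ be a topological group which is not amenable, and let $(G,\Pi_s(G))$ be its universal minimal strongly proximal flow. Then $G$ acts effectively on $\Pi_s(G)$ at every $t\in G$ such that the subgroup $\langle\mathrm{Aut}(G)t\rangle$ is dense in $G$; that is, for every such $t$ there is some $x\in\Pi_s(G)$ with $tx\neq x$.
   Context: A topological group is a group with a Hausdorff topology such that $(x,y)\mapsto xy^{-1}$ is continuous. A flow $(G,X)$ consists of a topological group $G$ and a (nonempty) compact Hausdorff space $X$ with a jointly continuous action $G\times X\to X$, $(t,x)\mapsto tx$. A flow is minimal if every orbit is dense; proximal if for all $x,y\in X$ there is a net $\{t_n\}$ in $G$ with $\lim t_nx=\lim t_ny$. $\mathcal M(X)$ is the compact convex set of (quasi-)regular Borel probability measures on $X$ with the weak-* topology; $G$ acts on it by push-forward. The flow $(G,X)$ is strongly proximal if $(G,\mathcal M(X))$ is proximal. The universal minimal strongly proximal flow $(G,\Pi_s(G))$ is the minimal strongly proximal flow, unique up to isomorphism, such that every minimal strongly proximal flow $(G,Y)$ is the image of $\Pi_s(G)$ under a continuous surjective $G$-equivariant map (existence and uniqueness are known). A topological group $G$ is amenable if every flow $(G,X)$ admits an invariant measure in $\mathcal M(X)$; it is known that this holds if and only if $\Pi_s(G)$ is a single point. $\mathrm{Aut}(G)$ is the group of topological automorphisms of $G$, $\mathrm{Aut}(G)t=\{a(t)\mid a\in\mathrm{Aut}(G)\}$, and $\langle\mathrm{Aut}(G)t\rangle$ is the subgroup algebraically generated by it. *)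

theory Defs
  imports
    "HOL-Algebra.Group_Action"
    "HOL-Algebra.Generated_Groups"
    "HOL-Probability.Probability"
begin

section \<open>Topological groups and flows\<close>

locale topological_group = group G for G (structure) +
  fixes T
  assumes topspace_eq_carrier: "topspace T = carrier G"
    and Hausdorff_group: "Hausdorff_space T"
    and continuous_mult_inv:
      "continuous_map (prod_topology T T) T (\<lambda>(x, y). x \<otimes> inv y)"

locale flow =
  topological_group G T + group_action G "topspace X" \<phi> for G (structure) and T X \<phi> +
  assumes nonempty_space: "topspace X \<noteq> {}"
    and compact_flow_space: "compact_space X"
    and Hausdorff_flow_space: "Hausdorff_space X"
    and continuous_action: "continuous_map (prod_topology T X) X (\<lambda>(g, x). \<phi> g x)"

definition minimal_action ::
  "('g, 'm) monoid_scheme \<Rightarrow> 'x topology \<Rightarrow> ('g \<Rightarrow> 'x \<Rightarrow> 'x) \<Rightarrow> bool" where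
  "minimal_action G X \<phi> \<longleftrightarrow> (\<forall>x \<in> topspace X. X closure_of (orbit G \<phi> x) = topspace X)"

text \<open>A net in \<open>G\<close> is represented by a proper filter concentrated on \<open>carrier G\<close>
  (the filter of its tails); convergence of \<open>t\<^sub>n x\<close> depends on this filter only.\<close>

definition proximal_action ::
  "('g, 'm) monoid_scheme \<Rightarrow> 'x topology \<Rightarrow> ('g \<Rightarrow> 'x \<Rightarrow> 'x) \<Rightarrow> bool" where
  "proximal_action G X \<phi> \<longleftrightarrow>
     (\<forall>x \<in> topspace X. \<forall>y \<in> topspace X.
        \<exists>F z. F \<noteq> bot \<and> (\<forall>\<^sub>F t in F. t \<in> carrier G) \<and>
              limitin X (\<lambda>t. \<phi> t x) z F \<and> limitin X (\<lambda>t. \<phi> t y) z F)"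


section \<open>Regular Borel probability measures\<close>

definition borel_on :: "'x topology \<Rightarrow> 'x measure" where
  "borel_on X = sigma (topspace X) {U. openin X U}"

definition regular_measure :: "'x topology \<Rightarrow> 'x measure \<Rightarrow> bool" where
  "regular_measure X \<mu> \<longleftrightarrow>
     (\<forall>B \<in> sets \<mu>.
        emeasure \<mu> B = (SUP K \<in> {K. K \<subseteq> B \<and> compactin X K}. emeasure \<mu> K) \<and>
        emeasure \<mu> B = (INF U \<in> {U. B \<subseteq> U \<and> openin X U}. emeasure \<mu> U))"

definition regular_prob_measures :: "'x topology \<Rightarrow> 'x measure set" where
  "regular_prob_measures X =
     {\<mu>. sets \<mu> = sets (borel_on X) \<and> prob_space \<mu> \<and> regular_measure X \<mu>}"

text \<open>The coarsest topology on the set of regular probability measures making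
  \<open>\<mu> \<mapsto> \<integral>f d\<mu>\<close> continuous for every continuous real function \<open>f\<close>.\<close>

definition weak_star :: "'x topology \<Rightarrow> 'x measure topology" where
  "weak_star X = topology_generated_by
     {{\<mu> \<in> regular_prob_measures X. (\<integral>x. f x \<partial>\<mu>) \<in> V} | f V.
        continuous_map X euclideanreal f \<and> open V}"

lemma topspace_weak_star: "topspace (weak_star X) = regular_prob_measures X"
proof -
  have "\<exists>f V. regular_prob_measures X = {\<mu> \<in> regular_prob_measures X. (\<integral>x. f x \<partial>\<mu>) \<in> V} \<and>
      continuous_map X euclideanreal f \<and> open V"
    by (rule exI[of _ "\<lambda>_. 0"], rule exI[of _ UNIV]) auto
  then show ?thesis
    unfolding weak_star_def topspace_def[symmetric] topology_generated_by_topspace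
    by blast
qed

definition measure_action :: "'x topology \<Rightarrow> ('g \<Rightarrow> 'x \<Rightarrow> 'x) \<Rightarrow> 'g \<Rightarrow> 'x measure \<Rightarrow> 'x measure" where
  "measure_action X \<phi> t = (\<lambda>\<mu> \<in> regular_prob_measures X. distr \<mu> (borel_on X) (\<phi> t))"


section \<open>Strong proximality, the universal flow, amenability\<close>

definition strongly_proximal_action ::
  "('g, 'm) monoid_scheme \<Rightarrow> 'x topology \<Rightarrow> ('g \<Rightarrow> 'x \<Rightarrow> 'x) \<Rightarrow> bool" where
  "strongly_proximal_action G X \<phi> \<longleftrightarrow> proximal_action G (weak_star X) (measure_action X \<phi>)"

definition minimal_strongly_proximal_flow ::
  "('g, 'm) monoid_scheme \<Rightarrow> 'g topology \<Rightarrow> 'x topology \<Rightarrow> ('g \<Rightarrow> 'x \<Rightarrow> 'x) \<Rightarrow> bool" where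
  "minimal_strongly_proximal_flow G T X \<phi> \<longleftrightarrow>
     flow G T X \<phi> \<and> minimal_action G X \<phi> \<and> strongly_proximal_action G X \<phi>"

definition factor_map ::
  "('g, 'm) monoid_scheme \<Rightarrow> 'x topology \<Rightarrow> ('g \<Rightarrow> 'x \<Rightarrow> 'x) \<Rightarrow>
     'y topology \<Rightarrow> ('g \<Rightarrow> 'y \<Rightarrow> 'y) \<Rightarrow> ('x \<Rightarrow> 'y) \<Rightarrow> bool" where
  "factor_map G X \<phi> Y \<psi> f \<longleftrightarrow>
     continuous_map X Y f \<and> f ` topspace X = topspace Y \<and>
     (\<forall>t \<in> carrier G. \<forall>x \<in> topspace X. f (\<phi> t x) = \<psi> t (f x))"

text \<open>A definition cannot quantify over all types. It suffices that the competitor \<open>Y\<close> ranges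
  over the topological spaces whose points lie in \<^typ>\<open>'g set set\<close>: up to isomorphism every
  minimal flow of \<open>G\<close> lives there, see \<open>minimal_flow_copy\<close> below.\<close>

definition universal_minimal_strongly_proximal_flow ::
  "('g, 'm) monoid_scheme \<Rightarrow> 'g topology \<Rightarrow> 'x topology \<Rightarrow> ('g \<Rightarrow> 'x \<Rightarrow> 'x) \<Rightarrow> bool" where
  "universal_minimal_strongly_proximal_flow G T X \<phi> \<longleftrightarrow>
     minimal_strongly_proximal_flow G T X \<phi> \<and>
     (\<forall>(Y :: 'g set set topology) \<psi>. minimal_strongly_proximal_flow G T Y \<psi> \<longrightarrow>
        (\<exists>f. factor_map G X \<phi> Y \<psi> f))"

definition invariant_measure ::
  "('g, 'm) monoid_scheme \<Rightarrow> 'x topology \<Rightarrow> ('g \<Rightarrow> 'x \<Rightarrow> 'x) \<Rightarrow> 'x measure \<Rightarrow> bool" where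
  "invariant_measure G X \<phi> \<mu> \<longleftrightarrow>
     \<mu> \<in> regular_prob_measures X \<and> (\<forall>t \<in> carrier G. measure_action X \<phi> t \<mu> = \<mu>)"

text \<open>Amenability tested on the flows whose points lie in the type \<^typ>\<open>'y\<close>; amenability of \<open>G\<close>
  is the conjunction of this over all types. Non-amenability therefore means that
  \<open>\<not> amenable_on TYPE('y) G T\<close> for some \<^typ>\<open>'y\<close>, and a theorem assuming the latter for
  an arbitrary type variable \<^typ>\<open>'y\<close> is a theorem about all non-amenable groups.\<close>

definition amenable_on ::
  "'y itself \<Rightarrow> ('g, 'm) monoid_scheme \<Rightarrow> 'g topology \<Rightarrow> bool" where
  "amenable_on _ G T \<longleftrightarrow>
     (\<forall>(X :: 'y topology) \<phi>. flow G T X \<phi> \<longrightarrow> (\<exists>\<mu>. invariant_measure G X \<phi> \<mu>))"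


section \<open>Topological automorphisms\<close>

definition topological_auto :: "('g, 'm) monoid_scheme \<Rightarrow> 'g topology \<Rightarrow> ('g \<Rightarrow> 'g) set" where
  "topological_auto G T = {a \<in> auto G. homeomorphic_map T T a}"


section \<open>Every minimal flow has an isomorphic copy on sets of sets of group elements\<close>

lemma group_actionI:
  assumes "group G"
    and closed: "\<And>g x. g \<in> carrier G \<Longrightarrow> x \<in> E \<Longrightarrow> \<phi> g x \<in> E"
    and ext: "\<And>g. g \<in> carrier G \<Longrightarrow> \<phi> g \<in> extensional E"
    and one: "\<And>x. x \<in> E \<Longrightarrow> \<phi> \<one>\<^bsub>G\<^esub> x = x"
    and mult: "\<And>g h x. g \<in> carrier G \<Longrightarrow> h \<in> carrier G \<Longrightarrow> x \<in> E \<Longrightarrow>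
      \<phi> (g \<otimes>\<^bsub>G\<^esub> h) x = \<phi> g (\<phi> h x)"
  shows "group_action G E \<phi>"
proof -
  interpret group G by (rule assms(1))
  have bij: "\<phi> g \<in> Bij E" if g: "g \<in> carrier G" for g
  proof -
    have "\<phi> g (\<phi> (inv\<^bsub>G\<^esub> g) x) = x" "\<phi> (inv\<^bsub>G\<^esub> g) (\<phi> g x) = x" if "x \<in> E" for x
      using mult[of g "inv\<^bsub>G\<^esub> g" x] mult[of "inv\<^bsub>G\<^esub> g" g x] one[OF that] g that by auto
    then have "bij_betw (\<phi> g) E E"
      using closed g by (intro bij_betw_byWitness[where f' = "\<phi> (inv\<^bsub>G\<^esub> g)"]) auto
    then show ?thesis using ext[OF g] by (simp add: Bij_def)
  qed
  have "\<phi> \<in> hom G (BijGroup E)"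
  proof (rule homI)
    fix g assume "g \<in> carrier G"
    then show "\<phi> g \<in> carrier (BijGroup E)" using bij by (simp add: BijGroup_def)
  next
    fix g h assume gh: "g \<in> carrier G" "h \<in> carrier G"
    have "\<phi> (g \<otimes>\<^bsub>G\<^esub> h) = compose E (\<phi> g) (\<phi> h)"
      by (rule extensionalityI[where A = E]) (use gh ext mult in \<open>auto simp: compose_eq\<close>)
    then show "\<phi> (g \<otimes>\<^bsub>G\<^esub> h) = \<phi> g \<otimes>\<^bsub>BijGroup E\<^esub> \<phi> h"
      using gh bij by (simp add: BijGroup_def)
  qed
  then show ?thesis
    unfolding group_action_def group_hom_def group_hom_axioms_def
    using group_BijGroup is_group by blast
qed

lemma homeomorphic_copy:
  assumes inj: "inj_on e (topspace X)"
  shows "\<exists>Y. homeomorphic_map X Y e"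
proof -
  let ?d = "inv_into (topspace X) e"
  define Y where "Y = pullback_topology (e ` topspace X) ?d X"
  have top: "topspace Y = e ` topspace X"
    unfolding Y_def topspace_pullback_topology using inj by auto
  have "continuous_map X Y e"
    unfolding Y_def
  proof (rule continuous_map_pullback')
    show "continuous_map X X (?d \<circ> e)"
      by (rule continuous_map_eq[OF continuous_map_id]) (use inj in auto)
  qed auto
  moreover have "continuous_map Y X ?d"
    using continuous_map_pullback[OF continuous_map_id[of X], of "e ` topspace X" ?d]
    by (simp add: Y_def)
  ultimately have "homeomorphic_maps X Y e ?d"
    unfolding homeomorphic_maps_def top using inj by (auto simp: f_inv_into_f)
  then show ?thesis using homeomorphic_map_maps by blast
qed

theorem minimal_flow_copy:
  fixes G :: "('g, 'm) monoid_scheme" and X :: "'x topology"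
  assumes "flow G T X \<phi>" and min: "minimal_action G X \<phi>"
  shows "\<exists>(Y :: 'g set set topology) \<psi> e.
    flow G T Y \<psi> \<and> homeomorphic_map X Y e \<and> factor_map G X \<phi> Y \<psi> e"
proof -
  interpret flow G T X \<phi> by fact
  obtain x0 where x0: "x0 \<in> topspace X" using nonempty_space by blast
  define e :: "'x \<Rightarrow> 'g set set" where
    "e x = {A. A \<subseteq> carrier G \<and> x \<in> X closure_of ((\<lambda>g. \<phi> g x0) ` A)}" for x
  have sub: "e x \<noteq> e y"
    if xy: "x \<in> topspace X" "y \<in> topspace X" "x \<noteq> y" for x y
  proof -
    obtain U V where UV: "openin X U" "openin X V" "x \<in> U" "y \<in> V" "disjnt U V"
      using Hausdorff_flow_space xy unfolding Hausdorff_space_def by meson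
    define A where "A = {g \<in> carrier G. \<phi> g x0 \<in> U}"
    have "x \<in> X closure_of (orbit G \<phi> x0)"
      using min x0 xy(1) by (simp add: minimal_action_def)
    then have "x \<in> X closure_of (U \<inter> orbit G \<phi> x0)"
      using UV by (metis IntI openin_Int_closure_of_subset subsetD)
    moreover have "U \<inter> orbit G \<phi> x0 = (\<lambda>g. \<phi> g x0) ` A"
      by (auto simp: A_def orbit_def)
    ultimately have "A \<in> e x" by (auto simp: e_def A_def)
    moreover have "A \<notin> e y"
      using UV unfolding e_def A_def in_closure_of disjnt_def by blast
    ultimately show ?thesis by blast
  qed
  then have inj: "inj_on e (topspace X)" unfolding inj_on_def by blast
  then obtain Y where Y: "homeomorphic_map X Y e" using homeomorphic_copy by blast
  then obtain d where d: "homeomorphic_maps X Y e d" using homeomorphic_map_maps by blast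
  have ce: "continuous_map X Y e" and cd: "continuous_map Y X d"
    and de: "\<And>x. x \<in> topspace X \<Longrightarrow> d (e x) = x"
    and ed: "\<And>y. y \<in> topspace Y \<Longrightarrow> e (d y) = y"
    using d by (auto simp: homeomorphic_maps_def)
  have e_in: "\<And>x. x \<in> topspace X \<Longrightarrow> e x \<in> topspace Y"
    and d_in: "\<And>y. y \<in> topspace Y \<Longrightarrow> d y \<in> topspace X"
    using ce cd by (auto simp: continuous_map_def Pi_iff)
  have el: "\<phi> g x \<in> topspace X" if "g \<in> carrier G" "x \<in> topspace X" for g x
    using element_image that by blast
  define \<psi> where "\<psi> g = (\<lambda>y \<in> topspace Y. e (\<phi> g (d y)))" for g
  have act: "group_action G (topspace Y) \<psi>"
  proof (rule group_actionI)
    show "group G" by (rule is_group)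
    show "\<psi> \<one>\<^bsub>G\<^esub> y = y" if "y \<in> topspace Y" for y
      using that d_in[OF that] ed id_eq_one by (metis \<psi>_def restrict_apply')
  qed (use el e_in d_in de composition_rule in \<open>auto simp: \<psi>_def\<close>)
  have hom: "X homeomorphic_space Y"
    using d by (auto simp: homeomorphic_space_def)
  have cont: "continuous_map (prod_topology T Y) Y (\<lambda>(g, y). \<psi> g y)"
  proof (rule continuous_map_eq)
    have "continuous_map (prod_topology T Y) (prod_topology T X) (\<lambda>p. (fst p, d (snd p)))"
      by (intro continuous_map_pairedI continuous_map_fst
          continuous_map_compose[OF continuous_map_snd cd, unfolded o_def])
    then show "continuous_map (prod_topology T Y) Y
        (e \<circ> ((\<lambda>(g, x). \<phi> g x) \<circ> (\<lambda>p. (fst p, d (snd p)))))"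
      by (intro continuous_map_compose[OF _ ce] continuous_map_compose[OF _ continuous_action])
  qed (auto simp: \<psi>_def)
  have "flow G T Y \<psi>"
  proof (intro flow.intro flow_axioms.intro)
    show "topological_group G T" by unfold_locales
    show "group_action G (topspace Y) \<psi>" by (rule act)
    show "topspace Y \<noteq> {}" using e_in x0 by blast
    show "compact_space Y" using hom compact_flow_space homeomorphic_compact_space by blast
    show "Hausdorff_space Y" using hom Hausdorff_flow_space homeomorphic_Hausdorff_space by blast
  qed (rule cont)
  moreover have "factor_map G X \<phi> Y \<psi> e"
    unfolding factor_map_def using ce e_in de homeomorphic_imp_surjective_map[OF Y]
    by (auto simp: \<psi>_def)
  ultimately show ?thesis using Y by blast
qed

end

theory Submission
  imports Defs
begin

text \<open>If \<open>t\<close> acts trivially on the universal flow \<open>X\<close>, then so does \<open>a t\<close> for every topological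
  automorphism \<open>a\<close>: twisting the action by \<open>a\<close> gives another minimal strongly proximal flow, which is
  a factor of \<open>X\<close>. The kernel of the action is closed, so it is all of \<open>G\<close>, and by minimality \<open>X\<close>
  and hence every minimal strongly proximal flow is a point.

  On the other hand, let \<open>Y\<close> be a flow without invariant measure. Represent measures on \<open>Y\<close> by states,
  that is, normalised positive functionals on \<open>C(Y)\<close>, and let \<open>Q\<close> be a minimal nonempty closed convex
  invariant set of states, with an extreme point \<open>z\<close>. For a state \<open>L\<close> on \<open>C(Q)\<close>, the barycentres of
  the states in the closed convex hull of the orbit of \<open>L\<close> form a closed convex invariant subset of
  \<open>Q\<close>, so \<open>z\<close> is one of them; and the only state with barycentre \<open>z\<close> is evaluation at \<open>z\<close>. As
  evaluation at \<open>z\<close> is itself extreme, translates of \<open>L\<close> converge to it. Hence the orbit closure of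
  \<open>z\<close> is minimal and strongly proximal. If it were a point, then \<open>z\<close> would be an invariant state, and
  the Riesz construction would turn it into an invariant measure.\<close>


section \<open>Regular measures and the weak-* topology\<close>

text \<open>Universality is tested only against flows on \<open>'g set set\<close>, whereas the
  twisted action and the orbit closure of \<open>z\<close> live on other types. Minimality and
  strong proximality therefore have to be carried across homeomorphisms, which is one use of the
  push-forward lemmas. Working with states instead of measures turns everything into sets of real
  functions on an index set: compactness comes from Tychonoff, while separation, extreme points and
  barycentres are handled coordinate by coordinate. Convergence to \<open>z\<close> is measured by
  the mean of the squared distance to \<open>z\<close> in finitely many coordinates. This quantity
  is linear in the state, so a lower bound on the orbit of \<open>L\<close> passes to the hull; and
  small values of it control the integral of any continuous function. Two measures are moved to
  \<open>z\<close> simultaneously by taking for \<open>L\<close> their average, since each of them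
  is at most \<open>2 * L\<close> on nonnegative functions.\<close>

lemma space_borel_on [simp]: "space (borel_on X) = topspace X"
  unfolding borel_on_def by (rule space_measure_of) (use openin_subset in blast)

lemma sets_borel_on: "sets (borel_on X) = sigma_sets (topspace X) {U. openin X U}"
  unfolding borel_on_def by (rule sets_measure_of) (use openin_subset in blast)

lemma openin_sets_borel_on: "openin X U \<Longrightarrow> U \<in> sets (borel_on X)"
  by (simp add: sets_borel_on)

lemma closedin_sets_borel_on:
  assumes "closedin X C" shows "C \<in> sets (borel_on X)"
proof -
  have "topspace X - (topspace X - C) \<in> sets (borel_on X)"
    using assms openin_sets_borel_on[of X "topspace X - C"] sets.compl_sets[of _ "borel_on X"]
    by (simp add: closedin_def)
  then show ?thesis using closedin_subset[OF assms] by (simp add: double_diff)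
qed

lemma measurable_borel_on:
  assumes "continuous_map X Y f" shows "f \<in> measurable (borel_on X) (borel_on Y)"
  unfolding borel_on_def[of Y]
proof (rule measurable_measure_of)
  show "f \<in> space (borel_on X) \<rightarrow> topspace Y"
    using assms by (auto simp: continuous_map_def)
  show "f -` U \<inter> space (borel_on X) \<in> sets (borel_on X)" if "U \<in> {U. openin Y U}" for U
  proof -
    have "f -` U \<inter> topspace X = {x \<in> topspace X. f x \<in> U}" by auto
    then show ?thesis
      using openin_continuous_map_preimage[OF assms, of U] that by (simp add: openin_sets_borel_on)
  qed
qed (use openin_subset in blast)

lemma borel_measurable_borel_on:
  fixes f :: "'a \<Rightarrow> real"
  assumes "continuous_map X euclideanreal f" shows "f \<in> borel_measurable (borel_on X)"
proof (rule borel_measurableI)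
  fix S :: "real set" assume "open S"
  have "f -` S \<inter> topspace X = {x \<in> topspace X. f x \<in> S}" by auto
  then show "f -` S \<inter> space (borel_on X) \<in> sets (borel_on X)"
    using openin_continuous_map_preimage[OF assms, of S] \<open>open S\<close>
    by (simp add: openin_sets_borel_on)
qed

lemma regular_prob_measuresD:
  assumes "\<mu> \<in> regular_prob_measures X"
  shows "sets \<mu> = sets (borel_on X)" "space \<mu> = topspace X" "prob_space \<mu>" "regular_measure X \<mu>"
  using assms sets_eq_imp_space_eq[of \<mu> "borel_on X"] by (auto simp: regular_prob_measures_def)

lemma bounded_continuous_on_compact_space:
  fixes f :: "'a \<Rightarrow> real"
  assumes "compact_space X" "continuous_map X euclideanreal f"
  obtains B where "B > 0" "\<And>x. x \<in> topspace X \<Longrightarrow> \<bar>f x\<bar> \<le> B"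
proof -
  have "compactin euclidean (f ` topspace X)"
    using assms image_compactin compact_space_def by blast
  then have "bounded (f ` topspace X)" by (simp add: compact_imp_bounded)
  then obtain B where "\<And>x. x \<in> topspace X \<Longrightarrow> \<bar>f x\<bar> \<le> B"
    by (auto simp: bounded_iff)
  then have "max B 1 > 0" "\<And>x. x \<in> topspace X \<Longrightarrow> \<bar>f x\<bar> \<le> max B 1" by fastforce+
  then show ?thesis by (rule that)
qed

lemma integrable_regular_prob_measure:
  fixes f :: "'a \<Rightarrow> real"
  assumes "compact_space X" "continuous_map X euclideanreal f" "\<mu> \<in> regular_prob_measures X"
  shows "integrable \<mu> f"
proof -
  interpret prob_space \<mu> using assms(3) by (rule regular_prob_measuresD)
  obtain B where "\<And>x. x \<in> topspace X \<Longrightarrow> \<bar>f x\<bar> \<le> B"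
    using bounded_continuous_on_compact_space[OF assms(1,2)] by blast
  moreover have "f \<in> borel_measurable \<mu>"
    using borel_measurable_borel_on[OF assms(2)] regular_prob_measuresD(1)[OF assms(3)]
    by (simp cong: measurable_cong_sets)
  ultimately show ?thesis
    by (intro integrable_const_bound[where B = B])
      (auto simp: regular_prob_measuresD(2)[OF assms(3)])
qed

text \<open>A homeomorphism matches compact sets with compact sets and open sets with open sets, so
  the approximations from inside and from outside transfer one by one. This serves twice: for a
  group element acting on measures and for moving measures between isomorphic flows.\<close>

lemma distr_regular_prob_measures:
  assumes ed: "homeomorphic_maps X Y e d" and H: "Hausdorff_space X"
    and \<mu>: "\<mu> \<in> regular_prob_measures X"
  shows "distr \<mu> (borel_on Y) e \<in> regular_prob_measures Y"
proof -
  note D = regular_prob_measuresD[OF \<mu>]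
  have ce: "continuous_map X Y e" and cd: "continuous_map Y X d"
    and de: "\<And>x. x \<in> topspace X \<Longrightarrow> d (e x) = x" and ed': "\<And>y. y \<in> topspace Y \<Longrightarrow> e (d y) = y"
    using ed by (auto simp: homeomorphic_maps_def)
  have hm: "homeomorphic_map X Y e" using ed homeomorphic_map_maps by blast
  have HY: "Hausdorff_space Y"
    using H ed homeomorphic_Hausdorff_space homeomorphic_space_def by blast
  have em: "e \<in> measurable \<mu> (borel_on Y)"
    using measurable_borel_on[OF ce] D(1) by (simp cong: measurable_cong_sets)
  interpret prob_space \<mu> by (rule D)
  let ?\<nu> = "distr \<mu> (borel_on Y) e"
  have val: "emeasure ?\<nu> B = emeasure \<mu> (e -` B \<inter> topspace X)" if "B \<in> sets (borel_on Y)" for B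
    using emeasure_distr[OF em that] D(2) by simp
  have im: "e -` (e ` A) \<inter> topspace X = A" if "A \<subseteq> topspace X" for A
    using that de by (auto simp: subset_iff; metis)
  \<comment> \<open>Compact sets in a Hausdorff space are closed, hence Borel, so \<open>val\<close>
    applies to them.\<close>
  have comp: "K \<in> sets (borel_on Y)" if "compactin Y K" for K
    using that HY closedin_sets_borel_on compactin_imp_closedin by blast
  have "regular_measure Y ?\<nu>"
    unfolding regular_measure_def
  proof safe
    fix B assume "B \<in> sets ?\<nu>"
    then have B: "B \<in> sets (borel_on Y)" by simp
    have BY: "B \<subseteq> topspace Y" using sets.sets_into_space[OF B] by simp
    let ?A = "e -` B \<inter> topspace X"
    have A: "?A \<in> sets \<mu>" using measurable_sets[OF em B] D(2) by simp
    have 1: "emeasure \<mu> ?A = (SUP K \<in> {K. K \<subseteq> ?A \<and> compactin X K}. emeasure \<mu> K)"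
     and 2: "emeasure \<mu> ?A = (INF U \<in> {U. ?A \<subseteq> U \<and> openin X U}. emeasure \<mu> U)"
      using D(4) A unfolding regular_measure_def by blast+
    show "emeasure ?\<nu> B = (SUP K \<in> {K. K \<subseteq> B \<and> compactin Y K}. emeasure ?\<nu> K)"
    proof (rule antisym)
      show "emeasure ?\<nu> B \<le> (SUP K \<in> {K. K \<subseteq> B \<and> compactin Y K}. emeasure ?\<nu> K)"
        unfolding val[OF B] 1
      proof (rule SUP_least)
        fix K assume K: "K \<in> {K. K \<subseteq> ?A \<and> compactin X K}"
        have c: "compactin Y (e ` K)" using K ce image_compactin by blast
        have "emeasure \<mu> K = emeasure ?\<nu> (e ` K)"
          using val[OF comp[OF c]] im[of K] K by auto
        also have "\<dots> \<le> (SUP K \<in> {K. K \<subseteq> B \<and> compactin Y K}. emeasure ?\<nu> K)"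
          using c K by (intro SUP_upper) auto
        finally show "emeasure \<mu> K \<le> (SUP K \<in> {K. K \<subseteq> B \<and> compactin Y K}. emeasure ?\<nu> K)" .
      qed
      show "(SUP K \<in> {K. K \<subseteq> B \<and> compactin Y K}. emeasure ?\<nu> K) \<le> emeasure ?\<nu> B"
        by (rule SUP_least) (use B in \<open>auto intro!: emeasure_mono\<close>)
    qed
    show "emeasure ?\<nu> B = (INF U \<in> {U. B \<subseteq> U \<and> openin Y U}. emeasure ?\<nu> U)"
    proof (rule antisym)
      show "(INF U \<in> {U. B \<subseteq> U \<and> openin Y U}. emeasure ?\<nu> U) \<le> emeasure ?\<nu> B"
        unfolding val[OF B] 2
      proof (rule INF_greatest)
        fix U assume U: "U \<in> {U. ?A \<subseteq> U \<and> openin X U}"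
        have o: "openin Y (e ` U)"
          using U hm homeomorphic_map_openness_eq by (metis mem_Collect_eq)
        have UX: "U \<subseteq> topspace X" using U openin_subset by blast
        have sub: "B \<subseteq> e ` U"
        proof
          fix y assume "y \<in> B"
          then have y: "y \<in> B" "y \<in> topspace Y" using BY by auto
          then have "d y \<in> ?A" using ed' cd by (auto simp: continuous_map_def)
          then have "e (d y) \<in> e ` U" using U by blast
          then show "y \<in> e ` U" using ed'[OF y(2)] by simp
        qed
        have "(INF U \<in> {U. B \<subseteq> U \<and> openin Y U}. emeasure ?\<nu> U) \<le> emeasure ?\<nu> (e ` U)"
          using o sub by (intro INF_lower) auto
        also have "\<dots> = emeasure \<mu> U"
          using val[OF openin_sets_borel_on[OF o]] im[OF UX] by simp
        finally show "(INF U \<in> {U. B \<subseteq> U \<and> openin Y U}. emeasure ?\<nu> U) \<le> emeasure \<mu> U" .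
      qed
      show "emeasure ?\<nu> B \<le> (INF U \<in> {U. B \<subseteq> U \<and> openin Y U}. emeasure ?\<nu> U)"
        by (rule INF_greatest) (auto intro!: emeasure_mono simp: openin_sets_borel_on)
    qed
  qed
  moreover have "prob_space ?\<nu>" by (rule prob_space_distr[OF em])
  ultimately show ?thesis by (simp add: regular_prob_measures_def)
qed

lemma integral_distr_continuous:
  fixes f :: "'b \<Rightarrow> real"
  assumes "continuous_map X Y e" "continuous_map Y euclideanreal f" "\<mu> \<in> regular_prob_measures X"
  shows "integral\<^sup>L (distr \<mu> (borel_on Y) e) f = (\<integral>x. f (e x) \<partial>\<mu>)"
proof (rule integral_distr)
  show "e \<in> measurable \<mu> (borel_on Y)"
    using measurable_borel_on[OF assms(1)] regular_prob_measuresD(1)[OF assms(3)]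
    by (simp cong: measurable_cong_sets)
qed (rule borel_measurable_borel_on[OF assms(2)])

text \<open>The point mass at \<open>z\<close> is the common limit in the proof of strong
  proximality. The approximating sets can be named: \<open>{z}\<close> from inside if
  \<open>z \<in> B\<close>, and from outside the whole space or the complement of
  \<open>{z}\<close>.\<close>

lemma return_regular_prob_measures:
  assumes H: "Hausdorff_space X" and z: "z \<in> topspace X"
  shows "return (borel_on X) z \<in> regular_prob_measures X"
proof -
  have "regular_measure X (return (borel_on X) z)"
    unfolding regular_measure_def
  proof safe
    fix B assume "B \<in> sets (return (borel_on X) z)"
    then have B: "B \<in> sets (borel_on X)" by simp
    let ?\<nu> = "return (borel_on X) z"
    have zc: "compactin X {z}" "closedin X {z}"
      using z H by (auto simp: closedin_Hausdorff_singleton)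
    have zs: "{z} \<in> sets (borel_on X)" "topspace X - {z} \<in> sets (borel_on X)"
      using zc(2) closedin_sets_borel_on openin_sets_borel_on by (blast+)
    show "emeasure ?\<nu> B = (SUP K \<in> {K. K \<subseteq> B \<and> compactin X K}. emeasure ?\<nu> K)"
    proof (rule antisym)
      show "emeasure ?\<nu> B \<le> (SUP K \<in> {K. K \<subseteq> B \<and> compactin X K}. emeasure ?\<nu> K)"
      proof (cases "z \<in> B")
        case True
        then have "emeasure ?\<nu> B = emeasure ?\<nu> {z}" using B zs by simp
        also have "\<dots> \<le> (SUP K \<in> {K. K \<subseteq> B \<and> compactin X K}. emeasure ?\<nu> K)"
          using zc True by (intro SUP_upper) auto
        finally show ?thesis .
      qed (use B in simp)
      show "(SUP K \<in> {K. K \<subseteq> B \<and> compactin X K}. emeasure ?\<nu> K) \<le> emeasure ?\<nu> B"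
        using B by (intro SUP_least emeasure_mono) auto
    qed
    show "emeasure ?\<nu> B = (INF U \<in> {U. B \<subseteq> U \<and> openin X U}. emeasure ?\<nu> U)"
    proof (rule antisym)
      show "(INF U \<in> {U. B \<subseteq> U \<and> openin X U}. emeasure ?\<nu> U) \<le> emeasure ?\<nu> B"
      proof (cases "z \<in> B")
        case True
        have "(INF U \<in> {U. B \<subseteq> U \<and> openin X U}. emeasure ?\<nu> U) \<le> emeasure ?\<nu> (topspace X)"
          using sets.sets_into_space[OF B] by (intro INF_lower) auto
        also have "\<dots> = emeasure ?\<nu> B" using True B z openin_sets_borel_on[of X "topspace X"] by simp
        finally show ?thesis .
      next
        case False
        have "(INF U \<in> {U. B \<subseteq> U \<and> openin X U}. emeasure ?\<nu> U) \<le> emeasure ?\<nu> (topspace X - {z})"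
          using sets.sets_into_space[OF B] zc False by (intro INF_lower) auto
        also have "\<dots> = emeasure ?\<nu> B" using False B zs by simp
        finally show ?thesis .
      qed
      show "emeasure ?\<nu> B \<le> (INF U \<in> {U. B \<subseteq> U \<and> openin X U}. emeasure ?\<nu> U)"
        by (intro INF_greatest emeasure_mono) (auto simp: openin_sets_borel_on)
    qed
  qed
  then show ?thesis using z by (simp add: regular_prob_measures_def prob_space_return)
qed

text \<open>Convergence need only be tested on the generating sets, by induction on how an open set
  arises from them. The clause on eventual membership is separate because the integrals alone do not
  tell whether \<open>h t\<close> is a regular probability measure.\<close>

lemma limitin_weak_star:
  "limitin (weak_star X) h l F \<longleftrightarrow>
     l \<in> regular_prob_measures X \<and> (\<forall>\<^sub>F t in F. h t \<in> regular_prob_measures X) \<and>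
     (\<forall>f. continuous_map X euclideanreal f \<longrightarrow>
       ((\<lambda>t. \<integral>x. f x \<partial>h t) \<longlongrightarrow> (\<integral>x. f x \<partial>l)) F)" (is "?L \<longleftrightarrow> ?R")
proof
  assume L: ?L
  have l: "l \<in> regular_prob_measures X"
    using limitin_topspace[OF L] by (simp add: topspace_weak_star)
  moreover have "\<forall>\<^sub>F t in F. h t \<in> regular_prob_measures X"
    using L l openin_topspace[of "weak_star X"] unfolding limitin_def topspace_weak_star by blast
  moreover have "((\<lambda>t. \<integral>x. f x \<partial>h t) \<longlongrightarrow> (\<integral>x. f x \<partial>l)) F"
    if f: "continuous_map X euclideanreal f" for f
  proof (rule topological_tendstoI)
    fix V :: "real set" assume V: "open V" "(\<integral>x. f x \<partial>l) \<in> V"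
    have "openin (weak_star X) {\<mu> \<in> regular_prob_measures X. (\<integral>x. f x \<partial>\<mu>) \<in> V}"
      unfolding weak_star_def by (rule topology_generated_by_Basis) (use f V in blast)
    then have "\<forall>\<^sub>F t in F. h t \<in> {\<mu> \<in> regular_prob_measures X. (\<integral>x. f x \<partial>\<mu>) \<in> V}"
      using L l V unfolding limitin_def by blast
    then show "\<forall>\<^sub>F t in F. (\<integral>x. f x \<partial>h t) \<in> V" by (rule eventually_mono) simp
  qed
  ultimately show ?R by blast
next
  assume R: ?R
  have "\<forall>\<^sub>F t in F. h t \<in> U" if "openin (weak_star X) U" "l \<in> U" for U
  proof -
    have "generate_topology_on {{\<mu> \<in> regular_prob_measures X. (\<integral>x. f x \<partial>\<mu>) \<in> V} | f V.
        continuous_map X euclideanreal f \<and> open V} U"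
      using that(1) by (simp add: weak_star_def openin_topology_generated_by_iff)
    then show ?thesis using that(2)
    proof (induction rule: generate_topology_on.induct)
      case (Int a b)
      then show ?case by (auto intro: eventually_conj)
    next
      case (UN K)
      then obtain k where "k \<in> K" "l \<in> k" by blast
      with UN.IH[of k] have "\<forall>\<^sub>F t in F. h t \<in> k" by blast
      then show ?case by (rule eventually_mono) (use \<open>k \<in> K\<close> in blast)
    next
      case (Basis s)
      then obtain f V where s: "s = {\<mu> \<in> regular_prob_measures X. (\<integral>x. f x \<partial>\<mu>) \<in> V}"
        and "continuous_map X euclideanreal f" "open V" by blast
      then have "\<forall>\<^sub>F t in F. (\<integral>x. f x \<partial>h t) \<in> V"
        using R Basis(2) topological_tendstoD by blast
      with R show ?case unfolding s by (auto elim: eventually_elim2)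
    qed simp
  qed
  then show ?L using R by (auto simp: limitin_def topspace_weak_star)
qed


section \<open>States and the Riesz construction\<close>

text \<open>The last clause fixes the values at discontinuous functions; without it the set of states
  would not be compact in the product topology.\<close>

definition states :: "'a topology \<Rightarrow> (('a \<Rightarrow> real) \<Rightarrow> real) set" where
  "states X = {L.
     (\<forall>f g. continuous_map X euclideanreal f \<longrightarrow> continuous_map X euclideanreal g \<longrightarrow>
        L (\<lambda>x. f x + g x) = L f + L g) \<and>
     (\<forall>c f. continuous_map X euclideanreal f \<longrightarrow> L (\<lambda>x. c * f x) = c * L f) \<and>
     (\<forall>f. continuous_map X euclideanreal f \<longrightarrow> (\<forall>x \<in> topspace X. 0 \<le> f x) \<longrightarrow> 0 \<le> L f) \<and>
     L (\<lambda>_. 1) = 1 \<and>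
     (\<forall>f. \<not> continuous_map X euclideanreal f \<longrightarrow> L f = 0)}"

lemma statesI:
  assumes "\<And>f g. continuous_map X euclideanreal f \<Longrightarrow> continuous_map X euclideanreal g \<Longrightarrow>
      L (\<lambda>x. f x + g x) = L f + L g"
    and "\<And>c f. continuous_map X euclideanreal f \<Longrightarrow> L (\<lambda>x. c * f x) = c * L f"
    and "\<And>f. continuous_map X euclideanreal f \<Longrightarrow> (\<And>x. x \<in> topspace X \<Longrightarrow> 0 \<le> f x) \<Longrightarrow> 0 \<le> L f"
    and "L (\<lambda>_. 1) = 1"
    and "\<And>f. \<not> continuous_map X euclideanreal f \<Longrightarrow> L f = 0"
  shows "L \<in> states X"
  using assms by (simp add: states_def)

context
  fixes X :: "'a topology" and L
  assumes L: "L \<in> states X"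
begin

lemma states_add:
  "continuous_map X euclideanreal f \<Longrightarrow> continuous_map X euclideanreal g \<Longrightarrow>
    L (\<lambda>x. f x + g x) = L f + L g"
  using L by (simp add: states_def)

lemma states_cmult: "continuous_map X euclideanreal f \<Longrightarrow> L (\<lambda>x. c * f x) = c * L f"
  using L by (simp add: states_def)

lemma states_nonneg:
  "continuous_map X euclideanreal f \<Longrightarrow> (\<And>x. x \<in> topspace X \<Longrightarrow> 0 \<le> f x) \<Longrightarrow> 0 \<le> L f"
  using L by (simp add: states_def)

lemma states_one: "L (\<lambda>_. 1) = 1"
  using L by (simp add: states_def)

lemma states_eq_0: "\<not> continuous_map X euclideanreal f \<Longrightarrow> L f = 0"
  using L by (simp add: states_def)

lemma states_const: "L (\<lambda>_. c) = c"
  using states_cmult[of "\<lambda>_. 1" c] states_one by simp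

lemma states_diff:
  assumes "continuous_map X euclideanreal f" "continuous_map X euclideanreal g"
  shows "L (\<lambda>x. f x - g x) = L f - L g"
  using states_add[OF assms(1), of "\<lambda>x. (-1) * g x"] states_cmult[OF assms(2), of "-1"] assms(2)
  by (simp add: continuous_map_minus)

lemma states_mono:
  assumes "continuous_map X euclideanreal f" "continuous_map X euclideanreal g"
    and "\<And>x. x \<in> topspace X \<Longrightarrow> f x \<le> g x"
  shows "L f \<le> L g"
  using states_nonneg[of "\<lambda>x. g x - f x"] states_diff[OF assms(2,1)] assms
  by (simp add: continuous_map_diff)

text \<open>Functions are total, so functions that agree on the space may still be different
  arguments of \<open>L\<close>. Positivity equates their values if they are continuous, and
  otherwise both values are 0.\<close>

lemma states_cong:
  assumes "\<And>x. x \<in> topspace X \<Longrightarrow> f x = g x"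
  shows "L f = L g"
proof -
  have iff: "continuous_map X euclideanreal f \<longleftrightarrow> continuous_map X euclideanreal g"
    using assms continuous_map_eq[of X euclideanreal] by metis
  show ?thesis
    using iff assms states_eq_0 by (cases "continuous_map X euclideanreal f")
      (auto intro!: antisym states_mono)
qed

lemma states_sum:
  assumes "finite I" "\<And>i. i \<in> I \<Longrightarrow> continuous_map X euclideanreal (f i)"
  shows "L (\<lambda>x. \<Sum>i\<in>I. f i x) = (\<Sum>i\<in>I. L (f i))"
  using assms
  by (induction I rule: finite_induct) (simp_all add: states_const states_add continuous_map_sum)

lemma states_bounded:
  assumes "continuous_map X euclideanreal f" "\<And>x. x \<in> topspace X \<Longrightarrow> \<bar>f x\<bar> \<le> B"
  shows "\<bar>L f\<bar> \<le> B"
proof -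
  have "L f \<le> L (\<lambda>_. B)" "L (\<lambda>_. -B) \<le> L f"
    using assms by (auto intro!: states_mono simp: abs_le_iff minus_le_iff)
  then show ?thesis by (simp add: states_const)
qed

end

text \<open>Riesz's supremum over functions between 0 and 1, asking only that they vanish outside
  \<open>U\<close>, not that their support lie inside it. Closed supports are recovered by
  \<open>truncate_state\<close>.\<close>

definition open_content :: "'a topology \<Rightarrow> (('a \<Rightarrow> real) \<Rightarrow> real) \<Rightarrow> 'a set \<Rightarrow> ennreal" where
  "open_content X L U = (SUP f \<in> {f. continuous_map X euclideanreal f \<and>
     (\<forall>x \<in> topspace X. 0 \<le> f x \<and> f x \<le> 1) \<and> (\<forall>x \<in> topspace X - U. f x = 0)}. ennreal (L f))"

definition state_outer_measure ::
  "'a topology \<Rightarrow> (('a \<Rightarrow> real) \<Rightarrow> real) \<Rightarrow> 'a set \<Rightarrow> ennreal" where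
  "state_outer_measure X L E = (INF U \<in> {U. openin X U \<and> E \<subseteq> U}. open_content X L U)"

text \<open>Only a regular measure inheriting the symmetries of \<open>L\<close> is needed below, so that it
  represents \<open>L\<close> is never proved.\<close>

locale compact_state =
  fixes X :: "'a topology" and L
  assumes compact_X: "compact_space X" and Hausdorff_X: "Hausdorff_space X"
    and state_L: "L \<in> states X"
begin

lemma open_content_upper:
  assumes "continuous_map X euclideanreal f"
    and "\<And>x. x \<in> topspace X \<Longrightarrow> 0 \<le> f x" "\<And>x. x \<in> topspace X \<Longrightarrow> f x \<le> 1"
    and "\<And>x. x \<in> topspace X - U \<Longrightarrow> f x = 0"
  shows "ennreal (L f) \<le> open_content X L U"
  unfolding open_content_def using assms by (intro SUP_upper) auto

lemma open_content_mono: "U \<subseteq> V \<Longrightarrow> open_content X L U \<le> open_content X L V"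
  unfolding open_content_def by (rule SUP_subset_mono) auto

lemma open_content_le_1: "open_content X L U \<le> 1"
  unfolding open_content_def
proof (rule SUP_least, clarify)
  fix f assume "continuous_map X euclideanreal f" "\<forall>x \<in> topspace X. 0 \<le> f x \<and> f x \<le> 1"
  then have "L f \<le> L (\<lambda>_. 1)" by (intro states_mono[OF state_L]) auto
  then show "ennreal (L f) \<le> 1" using states_one[OF state_L] by (simp add: ennreal_le_1)
qed

lemma open_content_topspace: "open_content X L (topspace X) = 1"
proof (rule antisym[OF open_content_le_1])
  have "ennreal (L (\<lambda>_. 1)) \<le> open_content X L (topspace X)" by (rule open_content_upper) auto
  then show "1 \<le> open_content X L (topspace X)" using states_one[OF state_L] by simp
qed

lemma open_content_empty: "open_content X L {} = 0"
proof -
  have "open_content X L {} \<le> 0"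
    unfolding open_content_def
  proof (rule SUP_least, clarify)
    fix f :: "'a \<Rightarrow> real" assume "\<forall>x \<in> topspace X - {}. f x = 0"
    then have "L f = L (\<lambda>_. 0)" by (intro states_cong[OF state_L]) auto
    then show "ennreal (L f) \<le> 0" using states_const[OF state_L] by simp
  qed
  then show ?thesis by simp
qed

text \<open>Cutting off at height \<open>e\<close> costs at most \<open>e\<close> in the value of
  the state and leaves a function that vanishes outside the closed set where
  \<open>e \<le> f\<close>. In a compact space this set is compact, as covering and separation
  arguments require.\<close>

lemma truncate_state:
  assumes f: "continuous_map X euclideanreal f" and "\<And>x. x \<in> topspace X \<Longrightarrow> 0 \<le> f x" and "0 < e"
  shows "continuous_map X euclideanreal (\<lambda>x. max 0 (f x - e))"
    and "L f \<le> L (\<lambda>x. max 0 (f x - e)) + e"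
    and "closedin X {x \<in> topspace X. e \<le> f x}"
proof -
  show c: "continuous_map X euclideanreal (\<lambda>x. max 0 (f x - e))"
    by (intro continuous_map_real_max continuous_map_diff f) auto
  have "L f \<le> L (\<lambda>x. max 0 (f x - e) + e)"
    by (intro states_mono[OF state_L] f continuous_map_add c) auto
  then show "L f \<le> L (\<lambda>x. max 0 (f x - e)) + e"
    using states_add[OF state_L c, of "\<lambda>_. e"] states_const[OF state_L] by simp
  show "closedin X {x \<in> topspace X. e \<le> f x}"
    using closedin_continuous_map_preimage[OF f, of "{e..}"] by simp
qed

text \<open>On the set where \<open>e \<le> f\<close> the parts outside \<open>U\<close> and outside
  \<open>V\<close> are disjoint and closed. A Urysohn function \<open>k\<close> for them splits the
  truncation of \<open>f\<close> into a summand vanishing outside \<open>U\<close> and one vanishing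
  outside \<open>V\<close>.\<close>

lemma open_content_Un:
  assumes U: "openin X U" and V: "openin X V"
  shows "open_content X L (U \<union> V) \<le> open_content X L U + open_content X L V"
  unfolding open_content_def[of X L "U \<union> V"]
proof (rule SUP_least, clarify)
  fix f assume f: "continuous_map X euclideanreal f" "\<forall>x \<in> topspace X. 0 \<le> f x \<and> f x \<le> 1"
    and f0: "\<forall>x \<in> topspace X - (U \<union> V). f x = 0"
  show "ennreal (L f) \<le> open_content X L U + open_content X L V"
  proof (rule ennreal_le_epsilon)
    fix e :: real assume e: "0 < e"
    note tr = truncate_state[OF f(1) _ e]
    define A where "A = {x \<in> topspace X. e \<le> f x} - U"
    define B where "B = {x \<in> topspace X. e \<le> f x} - V"
    have "closedin X A" "closedin X B" "disjnt A B"
      using tr(3) f U V f0 e by (auto simp: A_def B_def disjnt_def intro!: closedin_diff)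
    then obtain k where k: "continuous_map X (top_of_set {0..1::real}) k" "k ` A \<subseteq> {0}" "k ` B \<subseteq> {1}"
      using Urysohn_lemma[of X A B 0 1] compact_Hausdorff_or_regular_imp_normal_space compact_X Hausdorff_X
      by auto
    then have kc: "continuous_map X euclideanreal k" and k01: "\<And>x. x \<in> topspace X \<Longrightarrow> 0 \<le> k x \<and> k x \<le> 1"
      by (auto simp: continuous_map_in_subtopology)
    let ?g = "\<lambda>x. max 0 (f x - e)"
    let ?g1 = "\<lambda>x. ?g x * k x" and ?g2 = "\<lambda>x. ?g x * (1 - k x)"
    have gc: "continuous_map X euclideanreal ?g" using tr(1) f by auto
    have c1: "continuous_map X euclideanreal ?g1" and c2: "continuous_map X euclideanreal ?g2"
      by (auto intro!: continuous_map_real_mult continuous_map_diff gc kc)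
    have g01: "0 \<le> ?g x \<and> ?g x \<le> 1" if "x \<in> topspace X" for x
      using f(2) that e by (auto simp: max_def)
    have 1: "ennreal (L ?g1) \<le> open_content X L U"
    proof (rule open_content_upper[OF c1])
      fix x assume x: "x \<in> topspace X"
      show "0 \<le> ?g1 x" using g01[OF x] k01[OF x] by simp
      show "?g1 x \<le> 1" using g01[OF x] k01[OF x] by (intro mult_le_one) auto
    next
      fix x assume x: "x \<in> topspace X - U"
      show "?g1 x = 0" using x k(2) by (cases "e \<le> f x") (auto simp: A_def)
    qed
    have 2: "ennreal (L ?g2) \<le> open_content X L V"
    proof (rule open_content_upper[OF c2])
      fix x assume x: "x \<in> topspace X"
      show "0 \<le> ?g2 x" using g01[OF x] k01[OF x] by simp
      show "?g2 x \<le> 1" using g01[OF x] k01[OF x] by (intro mult_le_one) auto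
    next
      fix x assume x: "x \<in> topspace X - V"
      show "?g2 x = 0" using x k(3) by (cases "e \<le> f x") (auto simp: B_def)
    qed
    have "L f \<le> L ?g + e" using tr(2) f by auto
    also have "L ?g = L (\<lambda>x. ?g1 x + ?g2 x)" by (simp add: algebra_simps)
    also have "\<dots> = L ?g1 + L ?g2" by (rule states_add[OF state_L c1 c2])
    finally have "ennreal (L f) \<le> ennreal (L ?g1 + L ?g2 + e)" by (rule ennreal_leI)
    also have "\<dots> = ennreal (L ?g1) + ennreal (L ?g2) + ennreal e"
    proof -
      have "0 \<le> L ?g1" "0 \<le> L ?g2"
        using g01 k01 by (auto intro!: states_nonneg[OF state_L] c1 c2)
      then show ?thesis using e by simp
    qed
    also have "\<dots> \<le> open_content X L U + open_content X L V + ennreal e"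
      using 1 2 by (intro add_mono) auto
    finally show "ennreal (L f) \<le> open_content X L U + open_content X L V + ennreal e" .
  qed
qed

lemma open_content_finite_UN:
  assumes "finite J" "\<And>i. i \<in> J \<Longrightarrow> openin X (U i)"
  shows "open_content X L (\<Union>i\<in>J. U i) \<le> (\<Sum>i\<in>J. open_content X L (U i))"
  using assms
proof (induction J rule: finite_induct)
  case (insert i J)
  have "open_content X L (\<Union>i\<in>insert i J. U i) \<le> open_content X L (U i) + open_content X L (\<Union>i\<in>J. U i)"
    unfolding UN_insert by (rule open_content_Un) (use insert.prems in auto)
  also have "\<dots> \<le> (\<Sum>i\<in>insert i J. open_content X L (U i))"
    using insert by (simp add: add_left_mono)
  finally show ?case .
qed (simp add: open_content_empty)

text \<open>The truncation of \<open>f\<close> lives on a compact set, which finitely many of the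
  \<open>U n\<close> cover; finite subadditivity then bounds its value by a finite part of the
  series.\<close>

lemma open_content_UN:
  assumes U: "\<And>n::nat. openin X (U n)"
  shows "open_content X L (\<Union>n. U n) \<le> (\<Sum>n. open_content X L (U n))"
  unfolding open_content_def[of X L "\<Union>n. U n"]
proof (rule SUP_least, clarify)
  fix f assume f: "continuous_map X euclideanreal f" "\<forall>x \<in> topspace X. 0 \<le> f x \<and> f x \<le> 1"
    and f0: "\<forall>x \<in> topspace X - (\<Union>n. U n). f x = 0"
  show "ennreal (L f) \<le> (\<Sum>n. open_content X L (U n))"
  proof (rule ennreal_le_epsilon)
    fix e :: real assume e: "0 < e"
    note tr = truncate_state[OF f(1) _ e]
    let ?K = "{x \<in> topspace X. e \<le> f x}"
    have "closedin X ?K" using tr(3) f by auto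
    then have "compactin X ?K" by (rule closedin_compact_space[OF compact_X])
    moreover have "?K \<subseteq> \<Union> (range U)"
    proof
      fix x assume x: "x \<in> ?K"
      then have "f x \<noteq> 0" using e by auto
      then show "x \<in> \<Union> (range U)" using f0 x by blast
    qed
    ultimately obtain \<F> where "finite \<F>" "\<F> \<subseteq> range U" "?K \<subseteq> \<Union>\<F>"
      using U compactinD[of X ?K "range U"] by blast
    then obtain J where J: "finite J" "?K \<subseteq> (\<Union>n\<in>J. U n)"
      using finite_subset_image[of \<F> U UNIV] by metis
    let ?g = "\<lambda>x. max 0 (f x - e)"
    have "ennreal (L ?g) \<le> open_content X L (\<Union>n\<in>J. U n)"
    proof (rule open_content_upper)
      fix x assume "x \<in> topspace X - (\<Union>n\<in>J. U n)"
      then have "\<not> e \<le> f x" using J(2) by blast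
      then show "?g x = 0" by simp
    qed (use tr f e in \<open>force+\<close>)
    also have "\<dots> \<le> (\<Sum>n\<in>J. open_content X L (U n))"
      by (rule open_content_finite_UN[OF J(1) U])
    also have "\<dots> \<le> (\<Sum>n. open_content X L (U n))"
      by (rule sum_le_suminf) (use J in auto)
    finally have g: "ennreal (L ?g) \<le> (\<Sum>n. open_content X L (U n))" .
    have "ennreal (L f) \<le> ennreal (L ?g + e)"
      using tr(2) f by (intro ennreal_leI) auto
    also have "\<dots> = ennreal (L ?g) + ennreal e"
      using e tr(1) f by (intro ennreal_plus states_nonneg[OF state_L]) auto
    also have "\<dots> \<le> (\<Sum>n. open_content X L (U n)) + ennreal e"
      using g by (rule add_right_mono)
    finally show "ennreal (L f) \<le> (\<Sum>n. open_content X L (U n)) + ennreal e" .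
  qed
qed

lemma outer_open:
  assumes "openin X U" shows "state_outer_measure X L U = open_content X L U"
  unfolding state_outer_measure_def
  using assms by (intro antisym INF_greatest INF_lower) (auto intro: open_content_mono)

lemma outer_mono: "A \<subseteq> B \<Longrightarrow> state_outer_measure X L A \<le> state_outer_measure X L B"
  unfolding state_outer_measure_def by (rule INF_superset_mono) auto

lemma outer_finite:
  assumes "A \<subseteq> topspace X" shows "state_outer_measure X L A \<noteq> \<infinity>"
  using outer_mono[OF assms] outer_open[of "topspace X"] open_content_topspace
  by (auto simp: top_unique)

lemma outer_approx:
  assumes "A \<subseteq> topspace X" "0 < e"
  obtains U where "openin X U" "A \<subseteq> U" "open_content X L U \<le> state_outer_measure X L A + ennreal e"
  using INF_approx_ennreal[OF assms(2) state_outer_measure_def[of X L A]] outer_finite[OF assms(1)]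
  by (auto simp: infinity_ennreal_def intro: less_imp_le)

lemma outer_measure_space_state:
  "outer_measure_space (Pow (topspace X)) (state_outer_measure X L)"
  unfolding outer_measure_space_def
proof (intro conjI)
  show "positive (Pow (topspace X)) (state_outer_measure X L)"
    by (simp add: positive_def outer_open open_content_empty)
  show "increasing (Pow (topspace X)) (state_outer_measure X L)"
    by (simp add: increasing_def outer_mono)
  show "countably_subadditive (Pow (topspace X)) (state_outer_measure X L)"
    unfolding countably_subadditive_def
  proof (intro allI impI)
    fix A :: "nat \<Rightarrow> 'a set" assume A: "range A \<subseteq> Pow (topspace X)"
    show "state_outer_measure X L (\<Union>i. A i) \<le> (\<Sum>i. state_outer_measure X L (A i))"
    proof (rule ennreal_le_epsilon)
      fix e :: real assume e: "0 < e"
      have "\<exists>U. openin X U \<and> A n \<subseteq> U \<and>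
          open_content X L U \<le> state_outer_measure X L (A n) + ennreal (e * (1/2)^Suc n)" for n
      proof -
        have "A n \<subseteq> topspace X" "0 < e * (1/2)^Suc n" using A e by auto
        then show ?thesis by (rule outer_approx) blast
      qed
      then obtain U where U: "\<And>n. openin X (U n)" "\<And>n. A n \<subseteq> U n"
        "\<And>n. open_content X L (U n) \<le> state_outer_measure X L (A n) + ennreal (e * (1/2)^Suc n)"
        by metis
      have "state_outer_measure X L (\<Union>i. A i) \<le> state_outer_measure X L (\<Union>i. U i)"
        using U(2) by (intro outer_mono) blast
      also have "\<dots> = open_content X L (\<Union>i. U i)"
        by (rule outer_open) (use U(1) in blast)
      also have "\<dots> \<le> (\<Sum>n. open_content X L (U n))" by (rule open_content_UN[OF U(1)])
      also have "\<dots> \<le> (\<Sum>n. state_outer_measure X L (A n) + ennreal (e * (1/2)^Suc n))"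
        by (intro suminf_le U(3)) auto
      also have "\<dots> = (\<Sum>n. state_outer_measure X L (A n)) + (\<Sum>n. ennreal (e * (1/2)^Suc n))"
        by (rule suminf_add[symmetric]) auto
      also have "(\<Sum>n. ennreal (e * (1/2)^Suc n)) = ennreal e"
        using e sums_mult[OF power_half_series, of e] by (intro suminf_ennreal_eq) auto
      finally show "state_outer_measure X L (\<Union>i. A i) \<le> (\<Sum>i. state_outer_measure X L (A i)) + ennreal e" .
    qed
  qed
qed

text \<open>This is the hard half of Caratheodory's condition, for open test sets. Take
  \<open>f\<close> admissible for \<open>A \<inter> U\<close> and \<open>g\<close> admissible for
  \<open>A\<close> minus the set where \<open>e \<le> f\<close>. The truncation of \<open>f\<close>
  and \<open>g\<close> are never nonzero together, so their sum stays below 1 and is admissible for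
  \<open>A\<close>; and the open set on which \<open>g\<close> lives contains
  \<open>A - U\<close>.\<close>

lemma open_content_split:
  assumes U: "openin X U" and A: "openin X A"
  shows "open_content X L (A \<inter> U) + state_outer_measure X L (A - U) \<le> open_content X L A"
proof (cases "open_content X L (A \<inter> U) = 0")
  case True
  have "state_outer_measure X L (A - U) \<le> state_outer_measure X L A" by (rule outer_mono) blast
  then show ?thesis using True outer_open[OF A] by simp
next
  case False
  have split: "ennreal (L f) + state_outer_measure X L (A - U) \<le> open_content X L A"
    if f: "continuous_map X euclideanreal f" "\<forall>x \<in> topspace X. 0 \<le> f x \<and> f x \<le> 1"
      "\<forall>x \<in> topspace X - (A \<inter> U). f x = 0" for f
  proof (rule ennreal_le_epsilon)
    fix e :: real assume e: "0 < e"
    note tr = truncate_state[OF f(1) _ e]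
    let ?K = "{x \<in> topspace X. e \<le> f x}" and ?f = "\<lambda>x. max 0 (f x - e)"
    have o: "openin X (A - ?K)" using tr(3) f A by auto
    have fc: "continuous_map X euclideanreal ?f" using tr(1) f by auto
    have f0: "0 \<le> L ?f" by (intro states_nonneg[OF state_L] fc) auto
    have "ennreal (L ?f) + open_content X L (A - ?K) \<le> open_content X L A"
      unfolding open_content_def[of X L "A - ?K"]
    proof (subst ennreal_SUP_add_right)
      show "(SUP g\<in>{g. continuous_map X euclideanreal g \<and> (\<forall>x\<in>topspace X. 0 \<le> g x \<and> g x \<le> 1) \<and>
         (\<forall>x\<in>topspace X - (A - ?K). g x = 0)}. ennreal (L ?f) + ennreal (L g)) \<le> open_content X L A"
      proof (rule SUP_least, clarify)
        fix g assume g: "continuous_map X euclideanreal g" "\<forall>x\<in>topspace X. 0 \<le> g x \<and> g x \<le> 1"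
          "\<forall>x\<in>topspace X - (A - ?K). g x = 0"
        have "0 \<le> L g" by (rule states_nonneg[OF state_L g(1)]) (use g(2) in blast)
        then have "ennreal (L ?f) + ennreal (L g) = ennreal (L ?f + L g)" using f0 by simp
        also have "L ?f + L g = L (\<lambda>x. ?f x + g x)" by (rule states_add[OF state_L fc g(1), symmetric])
        also have "ennreal \<dots> \<le> open_content X L A"
        proof (rule open_content_upper)
          show "continuous_map X euclideanreal (\<lambda>x. ?f x + g x)" by (intro continuous_map_add fc g)
          fix x assume x: "x \<in> topspace X"
          show "0 \<le> ?f x + g x" using g x by auto
          show "?f x + g x \<le> 1" using g f x e by (cases "e \<le> f x") (auto simp: max_def)
        next
          fix x assume "x \<in> topspace X - A"
          then show "?f x + g x = 0" using f(3) g(3) e by auto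
        qed
        finally show "ennreal (L ?f) + ennreal (L g) \<le> open_content X L A" .
      qed
      show "{g. continuous_map X euclideanreal g \<and> (\<forall>x\<in>topspace X. 0 \<le> g x \<and> g x \<le> 1) \<and>
         (\<forall>x\<in>topspace X - (A - ?K). g x = 0)} \<noteq> {}"
        by (auto intro!: exI[of _ "\<lambda>_. 0"])
    qed
    moreover have "state_outer_measure X L (A - U) \<le> open_content X L (A - ?K)"
      unfolding outer_open[OF o, symmetric] by (rule outer_mono) (use f(3) e in \<open>auto; force\<close>)
    ultimately have 1: "ennreal (L ?f) + state_outer_measure X L (A - U) \<le> open_content X L A"
      by (meson add_left_mono order_trans)
    have "ennreal (L f) \<le> ennreal (L ?f + e)" using tr(2) f by (intro ennreal_leI) auto
    also have "\<dots> = ennreal (L ?f) + ennreal e" using f0 e by simp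
    finally have "ennreal (L f) \<le> ennreal (L ?f) + ennreal e" .
    then have "ennreal (L f) + state_outer_measure X L (A - U) \<le>
        ennreal (L ?f) + ennreal e + state_outer_measure X L (A - U)" by (rule add_right_mono)
    also have "\<dots> = ennreal (L ?f) + state_outer_measure X L (A - U) + ennreal e"
      by (simp add: ac_simps)
    also have "\<dots> \<le> open_content X L A + ennreal e" using 1 by (rule add_right_mono)
    finally show "ennreal (L f) + state_outer_measure X L (A - U) \<le> open_content X L A + ennreal e" .
  qed
  show ?thesis
    unfolding open_content_def[of X L "A \<inter> U"]
  proof (subst ennreal_SUP_add_left[symmetric])
    show "{f. continuous_map X euclideanreal f \<and> (\<forall>x\<in>topspace X. 0 \<le> f x \<and> f x \<le> 1) \<and>
        (\<forall>x\<in>topspace X - A \<inter> U. f x = 0)} \<noteq> {}"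
      by (auto intro!: exI[of _ "\<lambda>_. 0"])
  qed (rule SUP_least, use split in blast)
qed

text \<open>The outer measure of \<open>E\<close> is an infimum over open sets, so the inequality
  for open test sets extends to all \<open>E\<close>; the reverse inequality is
  subadditivity.\<close>

lemma open_in_lambda_system:
  assumes U: "openin X U"
  shows "U \<in> lambda_system (topspace X) (Pow (topspace X)) (state_outer_measure X L)"
  unfolding lambda_system_def
proof (clarify, intro conjI ballI)
  let ?m = "state_outer_measure X L"
  show "U \<in> Pow (topspace X)" using openin_subset[OF U] by simp
  fix E assume E: "E \<in> Pow (topspace X)"
  show "?m (U \<inter> E) + ?m ((topspace X - U) \<inter> E) = ?m E"
  proof (rule antisym)
    show "?m (U \<inter> E) + ?m ((topspace X - U) \<inter> E) \<le> ?m E"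
      unfolding state_outer_measure_def[of X L E]
    proof (rule INF_greatest, clarify)
      fix A assume A: "openin X A" "E \<subseteq> A"
      have "?m (U \<inter> E) + ?m ((topspace X - U) \<inter> E) \<le> ?m (A \<inter> U) + ?m (A - U)"
        using A(2) by (intro add_mono outer_mono) auto
      also have "\<dots> \<le> open_content X L A"
        using open_content_split[OF U A(1)] outer_open[OF openin_Int[OF A(1) U]] by simp
      finally show "?m (U \<inter> E) + ?m ((topspace X - U) \<inter> E) \<le> open_content X L A" .
    qed
    interpret P: algebra "topspace X" "Pow (topspace X)" by (rule algebra_Pow)
    have "subadditive (Pow (topspace X)) ?m"
      using outer_measure_space_state unfolding outer_measure_space_def
      by (intro P.countably_subadditive_subadditive) blast+
    from subadditiveD[OF this, of "U \<inter> E" "(topspace X - U) \<inter> E"]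
    have "?m ((U \<inter> E) \<union> ((topspace X - U) \<inter> E)) \<le> ?m (U \<inter> E) + ?m ((topspace X - U) \<inter> E)"
      using E by auto
    moreover have "(U \<inter> E) \<union> ((topspace X - U) \<inter> E) = E" using E by auto
    ultimately show "?m E \<le> ?m (U \<inter> E) + ?m ((topspace X - U) \<inter> E)" by simp
  qed
qed

section \<open>The regular Borel measure built from a state\<close>

definition state_measure :: "'a measure" where
  "state_measure = measure_of (topspace X) {U. openin X U} (state_outer_measure X L)"

lemma sets_state_measure: "sets state_measure = sets (borel_on X)"
  unfolding state_measure_def sets_borel_on by (rule sets_measure_of) (use openin_subset in blast)

lemma space_state_measure: "space state_measure = topspace X"
  using sets_eq_imp_space_eq[OF sets_state_measure] by simp

text \<open>\<open>measure_of\<close> returns the prescribed values only if they are countably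
  additive on the Borel sets. By Caratheodory they are so on the lambda system, a sigma-algebra that
  contains the open sets.\<close>

lemma emeasure_state_measure:
  assumes "A \<in> sets (borel_on X)"
  shows "emeasure state_measure A = state_outer_measure X L A"
proof (rule emeasure_measure_of[OF state_measure_def])
  let ?\<Lambda> = "lambda_system (topspace X) (Pow (topspace X)) (state_outer_measure X L)"
  interpret P: sigma_algebra "topspace X" "Pow (topspace X)" by (rule sigma_algebra_Pow)
  have ms: "measure_space (topspace X) ?\<Lambda> (state_outer_measure X L)"
    by (rule P.caratheodory_lemma[OF outer_measure_space_state])
  then interpret S: sigma_algebra "topspace X" ?\<Lambda> by (simp add: measure_space_def)
  have sub: "sets state_measure \<subseteq> ?\<Lambda>"
    unfolding sets_state_measure sets_borel_on
    by (rule S.sigma_sets_subset) (use open_in_lambda_system in blast)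
  show "positive (sets state_measure) (state_outer_measure X L)"
    by (simp add: positive_def outer_open open_content_empty)
  show "countably_additive (sets state_measure) (state_outer_measure X L)"
    using ms sub unfolding measure_space_def countably_additive_def by blast
qed (use openin_subset assms sets_state_measure in auto)

lemma emeasure_state_measure_open: "openin X U \<Longrightarrow> emeasure state_measure U = open_content X L U"
  by (simp add: emeasure_state_measure openin_sets_borel_on outer_open)

lemma prob_space_state_measure: "prob_space state_measure"
  by (rule prob_spaceI)
    (simp add: space_state_measure emeasure_state_measure_open open_content_topspace)

text \<open>Outer regularity is built into the construction. Inner regularity follows by
  complements: if an open \<open>U\<close> contains the complement of \<open>B\<close> with little
  excess, then the complement of \<open>U\<close> is a compact subset of \<open>B\<close> that
  misses little.\<close>

lemma regular_state_measure: "regular_measure X state_measure"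
  unfolding regular_measure_def sets_state_measure
proof (intro ballI conjI)
  interpret prob_space state_measure by (rule prob_space_state_measure)
  fix B assume B: "B \<in> sets (borel_on X)"
  have BX: "B \<subseteq> topspace X" using sets.sets_into_space[OF B] by simp
  show "emeasure state_measure B = (INF U \<in> {U. B \<subseteq> U \<and> openin X U}. emeasure state_measure U)"
    unfolding emeasure_state_measure[OF B] state_outer_measure_def
    by (rule INF_cong) (auto simp: emeasure_state_measure_open)
  show "emeasure state_measure B = (SUP K \<in> {K. K \<subseteq> B \<and> compactin X K}. emeasure state_measure K)"
  proof (rule antisym)
    show "emeasure state_measure B \<le> (SUP K \<in> {K. K \<subseteq> B \<and> compactin X K}. emeasure state_measure K)"
    proof (rule ennreal_le_epsilon)
      fix e :: real assume e: "0 < e"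
      let ?C = "topspace X - B"
      have C: "?C \<in> sets (borel_on X)" using sets.compl_sets[OF B] by simp
      obtain U where U: "openin X U" "?C \<subseteq> U" "open_content X L U \<le> state_outer_measure X L ?C + ennreal e"
        using outer_approx[of ?C e] e by blast
      let ?K = "topspace X - U"
      have K: "closedin X ?K" "?K \<subseteq> B" using U by auto
      then have Kc: "compactin X ?K" by (simp add: closedin_compact_space compact_X)
      have sU: "U \<in> sets state_measure" and sK: "?K \<in> sets state_measure"
        and sC: "?C \<in> sets state_measure" and sB: "B \<in> sets state_measure"
        using U(1) K(1) B C openin_sets_borel_on closedin_sets_borel_on
        by (auto simp: sets_state_measure)
      have "measure state_measure U \<le> measure state_measure ?C + e"
      proof -
        have "ennreal (measure state_measure U) \<le> ennreal (measure state_measure ?C + e)"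
          using U(3) e C unfolding emeasure_state_measure_open[OF U(1), symmetric]
            emeasure_state_measure[OF C, symmetric] emeasure_eq_measure by simp
        then show ?thesis using e by (subst (asm) ennreal_le_iff) auto
      qed
      moreover have "measure state_measure ?C = 1 - measure state_measure B"
        using prob_compl[OF sB] by (simp add: space_state_measure)
      moreover have "measure state_measure ?K = 1 - measure state_measure U"
        using prob_compl[OF sU] by (simp add: space_state_measure)
      ultimately have "measure state_measure B \<le> measure state_measure ?K + e" by simp
      then have "emeasure state_measure B \<le> emeasure state_measure ?K + ennreal e"
        using e by (simp add: emeasure_eq_measure flip: ennreal_plus)
      also have "\<dots> \<le> (SUP K \<in> {K. K \<subseteq> B \<and> compactin X K}. emeasure state_measure K) + ennreal e"
        using K Kc by (intro add_right_mono SUP_upper) auto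
      finally show "emeasure state_measure B \<le>
        (SUP K \<in> {K. K \<subseteq> B \<and> compactin X K}. emeasure state_measure K) + ennreal e" .
    qed
    show "(SUP K \<in> {K. K \<subseteq> B \<and> compactin X K}. emeasure state_measure K) \<le> emeasure state_measure B"
      by (rule SUP_least) (use B in \<open>auto intro!: emeasure_mono simp: sets_state_measure\<close>)
  qed
qed

lemma state_measure_in: "state_measure \<in> regular_prob_measures X"
  by (simp add: regular_prob_measures_def sets_state_measure prob_space_state_measure
      regular_state_measure)

text \<open>The measure is determined by the values of \<open>L\<close> and the open sets, so a
  symmetry of \<open>L\<close> passes through contents and outer measures to the measure itself. The
  inverse \<open>d\<close> is needed to move functions and open sets the other way.\<close>

lemma distr_state_measure:
  assumes ed: "homeomorphic_maps X X e d"
    and inv: "\<And>f. continuous_map X euclideanreal f \<Longrightarrow> L (\<lambda>x. f (e x)) = L f"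
  shows "distr state_measure (borel_on X) e = state_measure"
proof (rule measure_eqI)
  have ce: "continuous_map X X e" and cd: "continuous_map X X d"
    and de: "\<And>x. x \<in> topspace X \<Longrightarrow> d (e x) = x" and ed': "\<And>y. y \<in> topspace X \<Longrightarrow> e (d y) = y"
    using ed by (auto simp: homeomorphic_maps_def)
  have em: "e \<in> measurable state_measure (borel_on X)"
    using measurable_borel_on[OF ce] sets_state_measure by (simp cong: measurable_cong_sets)
  have eX: "e x \<in> topspace X" "d x \<in> topspace X" if "x \<in> topspace X" for x
    using that ce cd by (auto simp: continuous_map_def)
  have content: "open_content X L {x \<in> topspace X. e x \<in> U} = open_content X L U" for U
  proof (rule antisym)
    show "open_content X L {x \<in> topspace X. e x \<in> U} \<le> open_content X L U"
      unfolding open_content_def[of X L "{x \<in> topspace X. e x \<in> U}"]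
    proof (rule SUP_least, clarify)
      fix f assume f: "continuous_map X euclideanreal f" "\<forall>x \<in> topspace X. 0 \<le> f x \<and> f x \<le> 1"
        "\<forall>x \<in> topspace X - {x \<in> topspace X. e x \<in> U}. f x = 0"
      let ?g = "\<lambda>x. f (d x)"
      have gc: "continuous_map X euclideanreal ?g"
        using continuous_map_compose[OF cd f(1)] by (simp add: o_def)
      have "L f = L (\<lambda>x. ?g (e x))" using de by (intro states_cong[OF state_L]) simp
      also have "\<dots> = L ?g" by (rule inv[OF gc])
      finally have "ennreal (L f) = ennreal (L ?g)" by simp
      also have "\<dots> \<le> open_content X L U"
        by (rule open_content_upper[OF gc]) (use f(2,3) eX ed' in auto)
      finally show "ennreal (L f) \<le> open_content X L U" .
    qed
    show "open_content X L U \<le> open_content X L {x \<in> topspace X. e x \<in> U}"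
      unfolding open_content_def[of X L U]
    proof (rule SUP_least, clarify)
      fix f assume f: "continuous_map X euclideanreal f" "\<forall>x \<in> topspace X. 0 \<le> f x \<and> f x \<le> 1"
        "\<forall>x \<in> topspace X - U. f x = 0"
      let ?g = "\<lambda>x. f (e x)"
      have gc: "continuous_map X euclideanreal ?g"
        using continuous_map_compose[OF ce f(1)] by (simp add: o_def)
      have "ennreal (L f) = ennreal (L ?g)" using inv[OF f(1)] by simp
      also have "\<dots> \<le> open_content X L {x \<in> topspace X. e x \<in> U}"
        by (rule open_content_upper[OF gc]) (use f(2,3) eX in auto)
      finally show "ennreal (L f) \<le> open_content X L {x \<in> topspace X. e x \<in> U}" .
    qed
  qed
  fix B assume "B \<in> sets (distr state_measure (borel_on X) e)"
  then have B: "B \<in> sets (borel_on X)" by simp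
  have BX: "B \<subseteq> topspace X" using sets.sets_into_space[OF B] by simp
  have A: "e -` B \<inter> topspace X \<in> sets (borel_on X)"
    using measurable_sets[OF em B] by (simp add: space_state_measure sets_state_measure)
  have "emeasure (distr state_measure (borel_on X) e) B = state_outer_measure X L (e -` B \<inter> topspace X)"
    using emeasure_distr[OF em B] emeasure_state_measure[OF A] by (simp add: space_state_measure)
  also have "\<dots> = state_outer_measure X L B"
  proof (rule antisym)
    show "state_outer_measure X L (e -` B \<inter> topspace X) \<le> state_outer_measure X L B"
      unfolding state_outer_measure_def[of X L B]
    proof (rule INF_greatest, clarify)
      fix U assume U: "openin X U" "B \<subseteq> U"
      show "state_outer_measure X L (e -` B \<inter> topspace X) \<le> open_content X L U"
        unfolding content[of U, symmetric] state_outer_measure_def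
        by (rule INF_lower) (use U openin_continuous_map_preimage[OF ce U(1)] in auto)
    qed
    show "state_outer_measure X L B \<le> state_outer_measure X L (e -` B \<inter> topspace X)"
      unfolding state_outer_measure_def[of X L "e -` B \<inter> topspace X"]
    proof (rule INF_greatest, clarify)
      fix U assume U: "openin X U" "e -` B \<inter> topspace X \<subseteq> U"
      let ?V = "{y \<in> topspace X. d y \<in> U}"
      have V: "openin X ?V" by (rule openin_continuous_map_preimage[OF cd U(1)])
      have "{x \<in> topspace X. e x \<in> ?V} = U" using openin_subset[OF U(1)] de eX by auto
      then have eq: "open_content X L U = open_content X L ?V" using content[of ?V] by simp
      show "state_outer_measure X L B \<le> open_content X L U"
        unfolding eq state_outer_measure_def
      proof (rule INF_lower)
        show "?V \<in> {U. openin X U \<and> B \<subseteq> U}" using V BX U(2) eX ed' by fastforce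
      qed
    qed
  qed
  also have "\<dots> = emeasure state_measure B" using emeasure_state_measure[OF B] by simp
  finally show "emeasure (distr state_measure (borel_on X) e) B = emeasure state_measure B" .
qed (simp add: sets_state_measure)

end


section \<open>Compact convex sets of functions\<close>

lemma continuous_on_coordinate [continuous_intros]:
  "continuous_on S (\<lambda>q::'i \<Rightarrow> real. q i)"
  by (rule continuous_on_subset[OF continuous_on_product_coordinates]) simp

lemma compact_imp_closed_fun:
  fixes S :: "('i \<Rightarrow> real) set"
  assumes "compact S" shows "closed S"
proof -
  have "Hausdorff_space (euclidean :: ('i \<Rightarrow> real) topology)"
    unfolding euclidean_product_topology[symmetric] Hausdorff_space_product_topology by auto
  then show ?thesis using assms compactin_imp_closedin[of euclidean S] by simp
qed

lemma open_fun_coordinates: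
  fixes z :: "'i \<Rightarrow> real"
  assumes "open U" "z \<in> U"
  obtains J e where "finite J" "0 < e" "\<And>q. (\<And>i. i \<in> J \<Longrightarrow> \<bar>q i - z i\<bar> < e) \<Longrightarrow> q \<in> U"
proof -
  have "openin (product_topology (\<lambda>_. euclidean) UNIV) U"
    using assms(1) by (simp add: open_fun_def)
  from product_topology_open_contains_basis[OF this assms(2)]
  obtain V where V: "z \<in> (\<Pi>\<^sub>E i\<in>UNIV. V i)" "\<And>i. open (V i)"
    "finite {i. V i \<noteq> UNIV}" "(\<Pi>\<^sub>E i\<in>UNIV. V i) \<subseteq> U"
    by auto
  have "\<exists>d>0. \<forall>x. \<bar>x - z i\<bar> < d \<longrightarrow> x \<in> V i" for i
  proof -
    have "z i \<in> V i" using V(1) by auto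
    with V(2)[of i] show ?thesis by (metis dist_real_def open_dist)
  qed
  then obtain d where d: "\<And>i. 0 < d i" "\<And>i x. \<bar>x - z i\<bar> < d i \<Longrightarrow> x \<in> V i" by metis
  let ?J = "{i. V i \<noteq> UNIV}"
  \<comment> \<open>The inserted 1 keeps the minimum meaningful when no coordinate is
    restricted.\<close>
  let ?e = "Min (insert 1 (d ` ?J))"
  show ?thesis
  proof (rule that[OF V(3)])
    show "0 < ?e" using V(3) d(1) by (subst Min_gr_iff) auto
    fix q assume q: "\<And>i. i \<in> ?J \<Longrightarrow> \<bar>q i - z i\<bar> < ?e"
    have "q i \<in> V i" for i
    proof (cases "i \<in> ?J")
      case True
      have "?e \<le> d i" using V(3) True by (intro Min_le) auto
      with q[OF True] show ?thesis by (intro d(2)) simp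
    qed simp
    then show "q \<in> U" using V(4) by auto
  qed
qed

text \<open>For finite \<open>J\<close> these functions describe the neighbourhoods of
  \<open>p\<close> in the product topology. Unlike a neighbourhood, a continuous function of
  \<open>q\<close> can be the argument of a state, and a sum of squares turns means into
  variances.\<close>

definition sqdist_on :: "'i set \<Rightarrow> ('i \<Rightarrow> real) \<Rightarrow> ('i \<Rightarrow> real) \<Rightarrow> real" where
  "sqdist_on J p q = (\<Sum>i\<in>J. (q i - p i)\<^sup>2)"

lemma sqdist_on_nonneg: "0 \<le> sqdist_on J p q"
  by (simp add: sqdist_on_def sum_nonneg)

lemma sqdist_on_mono: "finite K \<Longrightarrow> J \<subseteq> K \<Longrightarrow> sqdist_on J p q \<le> sqdist_on K p q"
  by (simp add: sqdist_on_def sum_mono2)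

lemma continuous_on_sqdist_on [continuous_intros]:
  assumes "continuous_on S f" shows "continuous_on S (\<lambda>x. sqdist_on J p (f x))"
  unfolding sqdist_on_def
  by (intro continuous_intros continuous_on_product_then_coordinatewise[OF assms])

lemma sqdist_on_small:
  assumes "finite J" "0 < e" "sqdist_on J p q < e\<^sup>2" "i \<in> J"
  shows "\<bar>q i - p i\<bar> < e"
proof -
  have "(q i - p i)\<^sup>2 \<le> sqdist_on J p q"
    unfolding sqdist_on_def using assms by (intro member_le_sum) auto
  then have "\<bar>q i - p i\<bar>\<^sup>2 < e\<^sup>2" using assms(3) by simp
  then show ?thesis using assms(2) by (meson power_less_imp_less_base less_imp_le)
qed

lemma open_contains_sqdist_ball:
  fixes z :: "'i \<Rightarrow> real"
  assumes "open U" "z \<in> U"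
  obtains J e where "finite J" "0 < e" "\<And>q. sqdist_on J z q < e \<Longrightarrow> q \<in> U"
proof -
  obtain J e where J: "finite J" "0 < e" "\<And>q. (\<And>i. i \<in> J \<Longrightarrow> \<bar>q i - z i\<bar> < e) \<Longrightarrow> q \<in> U"
    using open_fun_coordinates[OF assms] by metis
  show ?thesis
  proof (rule that[OF J(1)])
    show "0 < e\<^sup>2" using J(2) by simp
    show "q \<in> U" if "sqdist_on J z q < e\<^sup>2" for q
      using J(3) sqdist_on_small[OF J(1,2) that] by blast
  qed
qed

text \<open>Near \<open>z\<close> continuity gives the error \<open>e\<close>; away from
  \<open>z\<close> the squared distance is bounded below, so a multiple of it exceeds the whole
  oscillation of \<open>f\<close>. Hence concentration of a measure at \<open>z\<close> can be read
  off from the means of \<open>sqdist_on J z\<close>.\<close>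

lemma continuous_dominated_by_sqdist:
  fixes Z :: "('i \<Rightarrow> real) set" and f :: "('i \<Rightarrow> real) \<Rightarrow> real"
  assumes Z: "compact Z" and f: "continuous_on Z f" and z: "z \<in> Z" and e: "0 < e"
  obtains J C where "finite J" "0 < C" "\<And>q. q \<in> Z \<Longrightarrow> \<bar>f q - f z\<bar> \<le> e + C * sqdist_on J z q"
proof -
  obtain U where U: "open U" "z \<in> U" "\<And>q. q \<in> Z \<Longrightarrow> q \<in> U \<Longrightarrow> \<bar>f q - f z\<bar> < e"
  proof -
    obtain U where "open U" "U \<inter> Z = f -` {f z - e<..<f z + e} \<inter> Z"
      using f by (meson continuous_on_open_invariant open_greaterThanLessThan)
    then show ?thesis using that[of U] z e by (auto simp: abs_less_iff) (smt (verit) Int_iff greaterThanLessThan_iff vimage_eq)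
  qed
  obtain J d where J: "finite J" "0 < d" "\<And>q. sqdist_on J z q < d \<Longrightarrow> q \<in> U"
    using open_contains_sqdist_ball[OF U(1,2)] by metis
  have "compact (f ` Z)" by (rule compact_continuous_image[OF f Z])
  then have "bounded (f ` Z)" by (rule compact_imp_bounded)
  then obtain B where B: "\<And>q. q \<in> Z \<Longrightarrow> \<bar>f q\<bar> \<le> B" by (auto simp: bounded_iff)
  have B0: "0 \<le> B" using B[OF z] by simp
  show ?thesis
  \<comment> \<open>Where the squared distance is at least \<open>d\<close>, the oscillation
    \<open>2 * B\<close> is at most \<open>2 * B / d\<close> times it. Adding 1 keeps the constant
    positive when \<open>B = 0\<close>.\<close>
  proof (rule that[OF J(1), of "2 * B / d + 1"])
    show "0 < 2 * B / d + 1" using J(2) B0 by (simp add: add_nonneg_pos)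
    fix q assume q: "q \<in> Z"
    show "\<bar>f q - f z\<bar> \<le> e + (2 * B / d + 1) * sqdist_on J z q"
    proof (cases "sqdist_on J z q < d")
      case True
      then have "\<bar>f q - f z\<bar> < e" using U(3) J(3) q by blast
      moreover have "0 \<le> (2 * B / d + 1) * sqdist_on J z q"
        using B0 J(2) sqdist_on_nonneg by (intro mult_nonneg_nonneg) auto
      ultimately show ?thesis by linarith
    next
      case False
      have "\<bar>f q - f z\<bar> \<le> 2 * B" using B[OF q] B[OF z] by linarith
      also have "2 * B = 2 * B / d * d" using J(2) by simp
      also have "\<dots> \<le> 2 * B / d * sqdist_on J z q"
        using False B0 J(2) by (intro mult_left_mono) auto
      also have "\<dots> \<le> e + (2 * B / d + 1) * sqdist_on J z q"
        using sqdist_on_nonneg[of J z q] e by (simp add: algebra_simps)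
      finally show ?thesis .
    qed
  qed
qed

text \<open>This is the Banach-Alaoglu argument: the values at \<open>f\<close> stay in an interval
  depending on \<open>f\<close> only, and every defining condition of a state involves finitely many
  coordinates at a time, hence is closed in the product.\<close>

lemma compact_states:
  assumes "compact_space X" shows "compact (states X)"
proof -
  have "\<exists>B. continuous_map X euclideanreal f \<longrightarrow> (\<forall>x\<in>topspace X. \<bar>f x\<bar> \<le> B)" for f :: "'a \<Rightarrow> real"
    using bounded_continuous_on_compact_space[OF assms] by metis
  then obtain B where B: "\<And>f x. continuous_map X euclideanreal f \<Longrightarrow> x \<in> topspace X \<Longrightarrow> \<bar>f x\<bar> \<le> B f"
    by metis
  \<comment> \<open>For discontinuous \<open>f\<close> the number \<open>B f\<close> is arbitrary;
    the absolute value ensures that the interval contains the value 0 taken there.\<close>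
  let ?S = "\<Pi>\<^sub>E f\<in>UNIV. {- \<bar>B f\<bar>..\<bar>B f\<bar>}"
  have "compactin (product_topology (\<lambda>_. euclideanreal) UNIV) ?S"
    by (subst compactin_PiE) auto
  then have "compact ?S" by (simp add: euclidean_product_topology)
  moreover have "closed (states X)"
    unfolding states_def
    by (intro closed_Collect_conj closed_Collect_all closed_Collect_imp open_Collect_const
        closed_Collect_eq closed_Collect_le continuous_intros)
  moreover have "states X \<subseteq> ?S"
  proof
    fix L assume L: "L \<in> states X"
    have "\<bar>L f\<bar> \<le> \<bar>B f\<bar>" for f
    proof (cases "continuous_map X euclideanreal f")
      case True
      then have "\<bar>L f\<bar> \<le> B f" by (rule states_bounded[OF L]) (rule B[OF True])
      then show ?thesis by simp
    qed (simp add: states_eq_0[OF L])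
    then show "L \<in> ?S" by (auto simp: abs_le_iff minus_le_iff)
  qed
  ultimately show ?thesis using compact_Int_closed[of ?S "states X"] by (simp add: Int_absorb1)
qed

text \<open>Zorn's lemma is applied to complements, which turns minimal into maximal; compactness
  keeps the intersection of a chain nonempty. \<open>P\<close> stays abstract because it will stand
  for closed faces as well as for closed convex invariant sets of states.\<close>

lemma minimal_closed_set:
  fixes S :: "'a::topological_space set"
  assumes S: "compact S" "P S"
    and P: "\<And>N. P N \<Longrightarrow> closed N \<and> N \<noteq> {} \<and> N \<subseteq> S"
    and Inter: "\<And>\<C>. \<C> \<noteq> {} \<Longrightarrow> (\<And>N. N \<in> \<C> \<Longrightarrow> P N) \<Longrightarrow> \<Inter>\<C> \<noteq> {} \<Longrightarrow> P (\<Inter>\<C>)"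
  shows "\<exists>M. P M \<and> (\<forall>N. P N \<longrightarrow> N \<subseteq> M \<longrightarrow> N = M)"
proof -
  have "\<exists>M\<in>uminus ` Collect P. \<forall>N\<in>uminus ` Collect P. M \<subseteq> N \<longrightarrow> N = M"
  proof (rule Zorn_Lemma2, rule ballI)
    fix \<D> assume D: "\<D> \<in> chains (uminus ` Collect P)"
    show "\<exists>U\<in>uminus ` Collect P. \<forall>N\<in>\<D>. N \<subseteq> U"
    proof (cases "\<D> = {}")
      case True then show ?thesis using S(2) by blast
    next
      case False
      let ?\<C> = "uminus ` \<D>"
      have PC: "P N" if "N \<in> ?\<C>" for N
        using that D by (auto simp: chains_def)
      have "S \<inter> \<Inter>?\<C> \<noteq> {}"
      proof (rule compact_imp_fip[OF S(1)])
        show "closed T" if "T \<in> ?\<C>" for T using PC[OF that] P by blast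
        fix F assume F: "finite F" "F \<subseteq> ?\<C>"
        \<comment> \<open>A nonempty finite subfamily of a chain has a least member; for the empty
          one \<open>S\<close> itself serves.\<close>
        have "\<exists>N. P N \<and> N \<subseteq> \<Inter>F"
        proof (cases "F = {}")
          case True then show ?thesis using S(2) by auto
        next
          case False
          then obtain N where N: "N \<in> F" "\<And>A. A \<in> F \<Longrightarrow> A \<subseteq> N \<Longrightarrow> N = A"
            using finite_has_minimal[OF F(1)] by metis
          have "N \<subseteq> A" if A: "A \<in> F" for A
          proof -
            have "- A \<in> \<D>" "- N \<in> \<D>" using A N(1) F(2) by auto
            then have "- A \<subseteq> - N \<or> - N \<subseteq> - A"
              using D unfolding chains_def chain_subset_def by blast
            then show ?thesis using N(2)[OF A] by auto
          qed
          then have "N \<subseteq> \<Inter>F" by blast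
          moreover have "P N" by (rule PC) (use N(1) F(2) in blast)
          ultimately show ?thesis by blast
        qed
        then show "S \<inter> \<Inter>F \<noteq> {}" using P by blast
      qed
      then have "\<Inter>?\<C> \<noteq> {}" by blast
      then have "P (\<Inter>?\<C>)" using Inter[of ?\<C>] PC False by blast
      moreover have "- (\<Inter>?\<C>) = \<Union>\<D>" by auto
      ultimately show ?thesis by (intro bexI[of _ "\<Union>\<D>"]) (auto simp: image_iff intro!: exI[of _ "\<Inter>?\<C>"])
    qed
  qed
  then obtain M where M: "P M" "\<And>N. P N \<Longrightarrow> - M \<subseteq> - N \<Longrightarrow> - N = - M" by auto
  then show ?thesis by (intro exI[of _ M]) auto
qed

section \<open>Convexity, barycentres and extreme points\<close>

definition convex_fun :: "('i \<Rightarrow> real) set \<Rightarrow> bool" where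
  "convex_fun S \<longleftrightarrow> (\<forall>p\<in>S. \<forall>q\<in>S. \<forall>u\<in>{0..1}. (\<lambda>i. (1 - u) * p i + u * q i) \<in> S)"

definition barycentre :: "((('i \<Rightarrow> real) \<Rightarrow> real) \<Rightarrow> real) \<Rightarrow> 'i \<Rightarrow> real" where
  "barycentre L = (\<lambda>i. L (\<lambda>q. q i))"

text \<open>A Hahn-Banach separation in finitely many coordinates: the separating functional comes from a
  point of \<open>Q\<close> closest to the barycentre.\<close>

lemma barycentre_in:
  fixes Q :: "('i \<Rightarrow> real) set"
  assumes Q: "compact Q" "convex_fun Q" "Q \<noteq> {}" and L: "L \<in> states (top_of_set Q)"
  shows "barycentre L \<in> Q"
proof (rule ccontr)
  let ?b = "barycentre L"
  assume "?b \<notin> Q"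
  then obtain J e where J: "finite J" "0 < e" "\<And>q. sqdist_on J ?b q < e \<Longrightarrow> q \<in> - Q"
    using open_contains_sqdist_ball[of "- Q" ?b] compact_imp_closed_fun[OF Q(1)]
    by (metis ComplI open_Compl)
  have "continuous_on Q (sqdist_on J ?b)"
    using continuous_on_sqdist_on[OF continuous_on_id] by simp
  then obtain q0 where q0: "q0 \<in> Q" "\<And>q. q \<in> Q \<Longrightarrow> sqdist_on J ?b q0 \<le> sqdist_on J ?b q"
    using continuous_attains_inf[OF Q(1,3)] by metis
  have pos: "0 < sqdist_on J ?b q0" using J(2) J(3)[of q0] q0(1) by fastforce
  \<comment> \<open>Half the derivative of the squared distance to the barycentre at
    \<open>q0\<close>, in the direction \<open>q - q0\<close>. It cannot be negative on
    \<open>Q\<close>, since \<open>q0\<close> is a nearest point.\<close>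
  let ?f = "\<lambda>q. \<Sum>i\<in>J. (q i - q0 i) * (q0 i - ?b i)"
  have f0: "0 \<le> ?f q" if q: "q \<in> Q" for q
  proof (rule ccontr)
    assume "\<not> 0 \<le> ?f q"
    then have neg: "?f q < 0" by simp
    define S where "S = (\<Sum>i\<in>J. (q i - q0 i)\<^sup>2)"
    have S0: "0 \<le> S" by (simp add: S_def sum_nonneg)
    \<comment> \<open>A step of length \<open>u\<close> from \<open>q0\<close> towards
      \<open>q\<close> changes the squared distance by \<open>u * (2 * ?f q + u * S)\<close>. This
      choice gives \<open>u * S \<le> - ?f q\<close>, so the change would be negative;
      \<open>S + 1\<close> avoids division by 0.\<close>
    define u where "u = min 1 (- ?f q / (S + 1))"
    have u: "0 < u" "u \<le> 1" using neg S0 by (auto simp: u_def field_simps)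
    have "(\<lambda>i. (1 - u) * q0 i + u * q i) \<in> Q"
      using Q(2) q q0(1) u by (auto simp: convex_fun_def)
    then have "sqdist_on J ?b q0 \<le> sqdist_on J ?b (\<lambda>i. (1 - u) * q0 i + u * q i)" by (rule q0(2))
    also have "\<dots> = (\<Sum>i\<in>J. (q0 i - ?b i)\<^sup>2 + 2 * u * ((q i - q0 i) * (q0 i - ?b i)) + u\<^sup>2 * (q i - q0 i)\<^sup>2)"
      unfolding sqdist_on_def by (rule sum.cong) (auto simp: power2_eq_square algebra_simps)
    also have "\<dots> = sqdist_on J ?b q0 + 2 * u * ?f q + u\<^sup>2 * S"
      by (simp add: sum.distrib sum_distrib_left sqdist_on_def S_def)
    finally have "0 \<le> u * (2 * ?f q + u * S)" by (simp add: power2_eq_square algebra_simps)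
    then have "0 \<le> 2 * ?f q + u * S" using u(1) by (simp add: zero_le_mult_iff)
    moreover have "u * S \<le> - ?f q"
    proof -
      have "u * S \<le> - ?f q / (S + 1) * S" using S0 by (intro mult_right_mono) (auto simp: u_def)
      also have "\<dots> \<le> - ?f q" using S0 neg by (simp add: field_simps)
      finally show ?thesis .
    qed
    ultimately show False using neg by linarith
  qed
  have cf: "continuous_on Q (\<lambda>q. (q i - c) * d)" for i c d by (intro continuous_intros)
  \<comment> \<open>\<open>?f\<close> is affine, so \<open>L\<close> maps it to its value at the
    barycentre, which is minus the squared distance from there to \<open>q0\<close>.\<close>
  have "0 \<le> L ?f" by (rule states_nonneg[OF L]) (auto intro!: continuous_intros f0)
  also have "L ?f = (\<Sum>i\<in>J. L (\<lambda>q. (q i - q0 i) * (q0 i - ?b i)))"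
    by (rule states_sum[OF L J(1)]) (simp add: cf)
  also have "\<dots> = (\<Sum>i\<in>J. (?b i - q0 i) * (q0 i - ?b i))"
  proof (rule sum.cong[OF refl])
    fix i
    have "L (\<lambda>q. (q0 i - ?b i) * (q i - q0 i)) = (q0 i - ?b i) * (L (\<lambda>q. q i) - q0 i)"
      using states_cmult[OF L, of "\<lambda>q. q i - q0 i"] states_diff[OF L, of "\<lambda>q. q i" "\<lambda>_. q0 i"]
        states_const[OF L] by (simp add: continuous_intros)
    then show "L (\<lambda>q. (q i - q0 i) * (q0 i - ?b i)) = (?b i - q0 i) * (q0 i - ?b i)"
      by (simp add: mult.commute barycentre_def)
  qed
  also have "\<dots> = - sqdist_on J ?b q0"
    unfolding sqdist_on_def sum_negf[symmetric]
    by (rule sum.cong) (auto simp: power2_eq_square algebra_simps)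
  finally show False using pos by simp
qed

text \<open>Only midpoints are tested, the form in which two opposite reweightings of a state will
  present \<open>z\<close>. That \<open>q = z\<close> as well follows from
  \<open>p = z\<close>.\<close>

definition extreme_fun :: "('i \<Rightarrow> real) set \<Rightarrow> ('i \<Rightarrow> real) \<Rightarrow> bool" where
  "extreme_fun Q z \<longleftrightarrow> z \<in> Q \<and> (\<forall>p\<in>Q. \<forall>q\<in>Q. (\<forall>i. z i = (p i + q i) / 2) \<longrightarrow> p = z)"

text \<open>Inside a closed face, the points where a given coordinate is maximal form a closed face
  again. On a minimal closed face every coordinate is therefore constant, so the face is a single
  point.\<close>

lemma extreme_fun_exists:
  fixes Q :: "('i \<Rightarrow> real) set"
  assumes Q: "compact Q" "Q \<noteq> {}"
  obtains z where "extreme_fun Q z"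
proof -
  define P where "P F \<longleftrightarrow> closed F \<and> F \<noteq> {} \<and> F \<subseteq> Q \<and>
    (\<forall>p\<in>Q. \<forall>q\<in>Q. (\<lambda>i. (p i + q i) / 2) \<in> F \<longrightarrow> p \<in> F \<and> q \<in> F)" for F
  have "P Q" using compact_imp_closed_fun Q unfolding P_def by blast
  have "P (\<Inter>\<C>)" if "\<C> \<noteq> {}" "\<And>N. N \<in> \<C> \<Longrightarrow> P N" "\<Inter>\<C> \<noteq> {}" for \<C>
    unfolding P_def
  proof (intro conjI closed_Inter ballI)
    show "closed N" if "N \<in> \<C>" for N using \<open>\<And>N. N \<in> \<C> \<Longrightarrow> P N\<close>[OF that] by (simp add: P_def)
  qed (use that P_def in blast)+
  note Int = this
  have "\<exists>M. P M \<and> (\<forall>N. P N \<longrightarrow> N \<subseteq> M \<longrightarrow> N = M)"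
  proof (rule minimal_closed_set[OF Q(1), of P])
    show "P Q" by fact
    show "closed N \<and> N \<noteq> {} \<and> N \<subseteq> Q" if "P N" for N using that by (simp add: P_def)
    show "P (\<Inter>\<C>)" if "\<C> \<noteq> {}" "\<And>N. N \<in> \<C> \<Longrightarrow> P N" "\<Inter>\<C> \<noteq> {}" for \<C> by (rule Int[OF that])
  qed
  then obtain M where M': "P M" "\<forall>N. P N \<longrightarrow> N \<subseteq> M \<longrightarrow> N = M" by (elim exE conjE)
  note M = M'(1)[unfolded P_def] M'(2)
  then obtain z where z: "z \<in> M" by blast
  have uniq: "y = z" if y: "y \<in> M" for y
  proof (rule ccontr)
    assume "y \<noteq> z"
    then obtain i where i: "y i \<noteq> z i" by auto
    have "compact M" using M(1) Q(1) compact_Int_closed[of Q M] by (simp add: Int_absorb1)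
    then have "\<exists>m\<in>M. \<forall>q\<in>M. q i \<le> m i"
      by (rule continuous_attains_sup) (use z in \<open>auto intro: continuous_on_coordinate\<close>)
    then obtain m where m: "m \<in> M" "\<And>q. q \<in> M \<Longrightarrow> q i \<le> m i" by blast
    let ?N = "{q \<in> M. q i = m i}"
    have "P ?N"
      unfolding P_def
    proof (intro conjI ballI impI)
      have "closed {q::'i \<Rightarrow> real. q i = m i}" by (intro closed_Collect_eq continuous_intros)
      then have "closed (M \<inter> {q. q i = m i})" using M(1) by blast
      then show "closed ?N" by (simp add: Int_def)
      fix p q assume pq: "p \<in> Q" "q \<in> Q" "(\<lambda>i. (p i + q i) / 2) \<in> ?N"
      then have "p \<in> M" "q \<in> M" using M(1) by blast+
      moreover from this have "p i = m i \<and> q i = m i" using m(2)[of p] m(2)[of q] pq(3) by auto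
      ultimately show "p \<in> ?N" "q \<in> ?N" by blast+
    qed (use M(1) m in blast)+
    then have "?N = M" using M(2) by simp
    then have "y i = m i" "z i = m i" using y z by blast+
    then show False using i by simp
  qed
  have "extreme_fun Q z"
    unfolding extreme_fun_def
  proof (intro conjI ballI impI)
    show "z \<in> Q" using z M(1) by blast
    fix p q assume pq: "p \<in> Q" "q \<in> Q" "\<forall>i. z i = (p i + q i) / 2"
    then have "(\<lambda>i. (p i + q i) / 2) = z" by auto
    then have "p \<in> M" using M(1) pq z by blast
    then show "p = z" by (rule uniq)
  qed
  then show ?thesis by (rule that)
qed

text \<open>The state with density \<open>c * h\<close> relative to \<open>L\<close>. The case
  distinction is genuine: where \<open>h\<close> vanishes, \<open>h x * f x\<close> can be
  continuous although \<open>f\<close> is not.\<close>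

lemma reweighted_state:
  assumes L: "L \<in> states X" and h: "continuous_map X euclideanreal h"
    "\<And>x. x \<in> topspace X \<Longrightarrow> 0 \<le> h x" and Lh: "c * L h = 1" and c: "0 \<le> c"
  shows "(\<lambda>f. if continuous_map X euclideanreal f then c * L (\<lambda>x. h x * f x) else 0) \<in> states X"
proof (rule statesI)
  fix f g :: "'a \<Rightarrow> real"
  assume "continuous_map X euclideanreal f" "continuous_map X euclideanreal g"
  then show "(if continuous_map X euclideanreal (\<lambda>x. f x + g x) then c * L (\<lambda>x. h x * (f x + g x)) else 0) =
      (if continuous_map X euclideanreal f then c * L (\<lambda>x. h x * f x) else 0) +
      (if continuous_map X euclideanreal g then c * L (\<lambda>x. h x * g x) else 0)"
    using states_add[OF L, of "\<lambda>x. h x * f x" "\<lambda>x. h x * g x"] h(1)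
    by (simp add: continuous_map_add continuous_map_real_mult algebra_simps)
next
  fix d and f :: "'a \<Rightarrow> real" assume "continuous_map X euclideanreal f"
  then show "(if continuous_map X euclideanreal (\<lambda>x. d * f x) then c * L (\<lambda>x. h x * (d * f x)) else 0) =
      d * (if continuous_map X euclideanreal f then c * L (\<lambda>x. h x * f x) else 0)"
    using states_cmult[OF L, of "\<lambda>x. h x * f x" d] h(1)
    by (simp add: continuous_map_real_mult continuous_map_real_mult_left mult.left_commute)
next
  fix f :: "'a \<Rightarrow> real" assume f: "continuous_map X euclideanreal f" "\<And>x. x \<in> topspace X \<Longrightarrow> 0 \<le> f x"
  have "0 \<le> L (\<lambda>x. h x * f x)"
    by (rule states_nonneg[OF L]) (use f h in \<open>auto intro: continuous_map_real_mult\<close>)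
  then show "0 \<le> (if continuous_map X euclideanreal f then c * L (\<lambda>x. h x * f x) else 0)"
    using c by simp
qed (use Lh in auto)

text \<open>For small \<open>r\<close> the densities \<open>1 \<plusminus> 2 r (q i - z i)\<close> split \<open>L\<close> as the midpoint of two states, whose
  barycentres are both \<open>z\<close> by extremality; this makes \<open>q i - z i\<close> orthogonal to all coordinates.\<close>

lemma extreme_point_representing_state:
  fixes Q :: "('i \<Rightarrow> real) set"
  assumes Q: "compact Q" "convex_fun Q" and z: "extreme_fun Q z"
    and L: "L \<in> states (top_of_set Q)" and bL: "barycentre L = z"
  shows "L (\<lambda>q. (q i - z i)\<^sup>2) = 0"
proof -
  have zQ: "z \<in> Q" using z by (simp add: extreme_fun_def)
  have ci: "continuous_on Q (\<lambda>q. q i)" for i by (intro continuous_intros)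
  have Lq: "L (\<lambda>q. q i) = z i" for i using bL unfolding barycentre_def by metis
  have "compact ((\<lambda>q. q i - z i) ` Q)"
    by (intro compact_continuous_image Q continuous_intros)
  then have "bounded ((\<lambda>q. q i - z i) ` Q)" by (rule compact_imp_bounded)
  then obtain B0 where B0: "\<And>q. q \<in> Q \<Longrightarrow> \<bar>q i - z i\<bar> \<le> B0" by (auto simp: bounded_iff)
  define B where "B = max B0 1"
  have B: "0 < B" "\<And>q. q \<in> Q \<Longrightarrow> \<bar>q i - z i\<bar> \<le> B" using B0 by (auto simp: B_def le_max_iff_disj)
  \<comment> \<open>Half of the density; the factor 2 is restored in \<open>N\<close>. As
    \<open>\<bar>q i - z i\<bar> \<le> B\<close>, the values are nonnegative on \<open>Q\<close> as
    long as \<open>\<bar>r\<bar> * B = 1/2\<close>.\<close>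
  define h where "h r q = 1/2 + r * (q i - z i)" for r and q :: "'i \<Rightarrow> real"
  have ch: "continuous_on Q (h r)" for r unfolding h_def by (intro continuous_intros)
  have h0: "0 \<le> h r q" if q: "q \<in> Q" and r: "\<bar>r\<bar> * (2 * B) = 1" for r q
  proof -
    have "\<bar>r * (q i - z i)\<bar> \<le> \<bar>r\<bar> * B"
      unfolding abs_mult by (rule mult_left_mono[OF B(2)[OF q]]) simp
    also have "\<dots> = 1/2" using r by simp
    finally have "- (r * (q i - z i)) \<le> 1/2" by (rule abs_le_D2)
    then show ?thesis unfolding h_def by linarith
  qed
  have Ld: "L (\<lambda>q. q i - z i) = 0"
    using states_diff[OF L, of "\<lambda>q. q i" "\<lambda>_. z i"] states_const[OF L] Lq ci by simp
  have Lh: "2 * L (h r) = 1" for r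
  proof -
    have "L (\<lambda>q. 1/2 + r * (q i - z i)) = 1/2"
      using states_add[OF L, of "\<lambda>_. 1/2" "\<lambda>q. r * (q i - z i)"]
        states_cmult[OF L, of "\<lambda>q. q i - z i" r] states_const[OF L] Ld
      by (simp add: continuous_intros)
    then show ?thesis by (simp add: h_def[abs_def])
  qed
  define N where "N r f = (if continuous_on Q f then 2 * L (\<lambda>q. h r q * f q) else 0)" for r f
  have N: "N r \<in> states (top_of_set Q)" if "\<bar>r\<bar> * (2 * B) = 1" for r
    using reweighted_state[OF L, of "h r" 2] ch Lh h0 that
    by (simp add: N_def[abs_def])
  have bN: "barycentre (N r) \<in> Q" if "\<bar>r\<bar> * (2 * B) = 1" for r
    by (rule barycentre_in[OF Q _ N[OF that]]) (use zQ in auto)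
  have N_eq: "N r (\<lambda>q. q j) = z j + 2 * r * L (\<lambda>q. (q i - z i) * q j)" for r j
  proof -
    have "L (\<lambda>q. h r q * q j) = L (\<lambda>q. 1/2 * q j + r * ((q i - z i) * q j))"
      by (simp add: h_def algebra_simps)
    also have "\<dots> = 1/2 * z j + r * L (\<lambda>q. (q i - z i) * q j)"
    proof -
      have "continuous_on Q (\<lambda>q. (q i - z i) * q j)" "continuous_on Q (\<lambda>q. 1/2 * q j)"
        "continuous_on Q (\<lambda>q. r * ((q i - z i) * q j))"
        by (intro continuous_intros)+
      then show ?thesis
        using states_add[OF L, of "\<lambda>q. 1/2 * q j" "\<lambda>q. r * ((q i - z i) * q j)"]
          states_cmult[OF L, of "\<lambda>q. (q i - z i) * q j" r]
          states_cmult[OF L, of "\<lambda>q. q j" "1/2"] Lq ci by simp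
    qed
    finally show ?thesis using ci by (simp add: N_def)
  qed
  define r where "r = 1 / (2 * B)"
  have r: "\<bar>r\<bar> * (2 * B) = 1" "\<bar>- r\<bar> * (2 * B) = 1" "r \<noteq> 0" using B(1) by (auto simp: r_def)
  \<comment> \<open>The terms linear in \<open>r\<close> cancel between \<open>r\<close> and
    \<open>- r\<close>.\<close>
  have "\<forall>j. z j = (barycentre (N r) j + barycentre (N (- r)) j) / 2"
    by (simp add: barycentre_def N_eq)
  then have "barycentre (N r) = z"
    using z bN[OF r(1)] bN[OF r(2)] unfolding extreme_fun_def by blast
  then have "N r (\<lambda>q. q i) = z i" unfolding barycentre_def by metis
  then have Lqq: "L (\<lambda>q. (q i - z i) * q i) = 0" using N_eq[of r i] r(3) by simp
  have cc: "continuous_on Q (\<lambda>q. (q i - z i) * q i)" "continuous_on Q (\<lambda>q. z i * (q i - z i))"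
    "continuous_on Q (\<lambda>q. q i - z i)" by (intro continuous_intros)+
  \<comment> \<open>In this splitting the first mean vanishes by extremality, in the coordinate
    \<open>i\<close> itself, and the second because \<open>z\<close> is the barycentre.\<close>
  have "L (\<lambda>q. (q i - z i)\<^sup>2) = L (\<lambda>q. (q i - z i) * q i - z i * (q i - z i))"
    by (simp add: power2_eq_square algebra_simps)
  also have "\<dots> = L (\<lambda>q. (q i - z i) * q i) - z i * L (\<lambda>q. q i - z i)"
    using states_diff[OF L, of "\<lambda>q. (q i - z i) * q i" "\<lambda>q. z i * (q i - z i)"]
      states_cmult[OF L, of "\<lambda>q. q i - z i" "z i"] cc by simp
  finally show ?thesis using Lqq Ld by simp
qed


section \<open>Irreducible affine systems\<close>

context flow
begin

lemma continuous_map_action: "t \<in> carrier G \<Longrightarrow> continuous_map X X (\<phi> t)"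
proof -
  assume t: "t \<in> carrier G"
  have "continuous_map X (prod_topology T X) (\<lambda>x. (t, x))"
    using t by (intro continuous_map_pairedI) (auto simp: topspace_eq_carrier)
  from continuous_map_compose[OF this continuous_action] show ?thesis by (simp add: o_def)
qed

lemma action_in: "t \<in> carrier G \<Longrightarrow> x \<in> topspace X \<Longrightarrow> \<phi> t x \<in> topspace X"
  using element_image by blast

lemma action_one: "x \<in> topspace X \<Longrightarrow> \<phi> \<one> x = x"
  using id_eq_one by (metis restrict_apply')

lemma action_inv:
  assumes "t \<in> carrier G" "x \<in> topspace X"
  shows "\<phi> t (\<phi> (inv t) x) = x" "\<phi> (inv t) (\<phi> t x) = x"
  using assms composition_rule[of x t "inv t"] composition_rule[of x "inv t" t] action_one by auto

lemma homeomorphic_maps_action: "t \<in> carrier G \<Longrightarrow> homeomorphic_maps X X (\<phi> t) (\<phi> (inv t))"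
  by (simp add: homeomorphic_maps_def continuous_map_action action_inv)

lemma measure_action_in:
  "t \<in> carrier G \<Longrightarrow> \<mu> \<in> regular_prob_measures X \<Longrightarrow> measure_action X \<phi> t \<mu> \<in> regular_prob_measures X"
  using distr_regular_prob_measures[OF homeomorphic_maps_action Hausdorff_flow_space]
  by (simp add: measure_action_def)

lemma integral_measure_action:
  fixes f :: "'c \<Rightarrow> real"
  assumes "t \<in> carrier G" "\<mu> \<in> regular_prob_measures X" "continuous_map X euclideanreal f"
  shows "integral\<^sup>L (measure_action X \<phi> t \<mu>) f = (\<integral>x. f (\<phi> t x) \<partial>\<mu>)"
  using integral_distr_continuous[OF continuous_map_action[OF assms(1)] assms(3,2)] assms(2)
  by (simp add: measure_action_def)

end

text \<open>The action permutes indices, so it is affine and continuous in \<open>q\<close>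
  automatically. The model is a set of states with \<open>\<pi> t f\<close> the composition of
  \<open>f\<close> with \<open>\<phi> t\<close>; composition reverses products, hence the order in
  \<open>mult_Q\<close>. The laws are required only at points of \<open>Q\<close>, because states
  ignore what \<open>f\<close> does outside the space.\<close>

locale irreducible_affine_system = topological_group G T for G (structure) and T +
  fixes Q :: "('i \<Rightarrow> real) set" and \<pi> :: "'a \<Rightarrow> 'i \<Rightarrow> 'i"
  assumes compact_Q: "compact Q" and convex_Q: "convex_fun Q" and nonempty_Q: "Q \<noteq> {}"
    and maps_Q: "\<And>t q. t \<in> carrier G \<Longrightarrow> q \<in> Q \<Longrightarrow> (\<lambda>i. q (\<pi> t i)) \<in> Q"
    and one_Q: "\<And>q i. q \<in> Q \<Longrightarrow> q (\<pi> \<one> i) = q i"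
    and mult_Q: "\<And>s t q i. s \<in> carrier G \<Longrightarrow> t \<in> carrier G \<Longrightarrow> q \<in> Q \<Longrightarrow>
      q (\<pi> (s \<otimes> t) i) = q (\<pi> t (\<pi> s i))"
    and continuous_Q: "\<And>i. continuous_map (prod_topology T (top_of_set Q)) euclideanreal (\<lambda>(t, q). q (\<pi> t i))"
    and irreducible_Q: "\<And>N. closed N \<Longrightarrow> N \<subseteq> Q \<Longrightarrow> N \<noteq> {} \<Longrightarrow> convex_fun N \<Longrightarrow>
      (\<And>t q. t \<in> carrier G \<Longrightarrow> q \<in> N \<Longrightarrow> (\<lambda>i. q (\<pi> t i)) \<in> N) \<Longrightarrow> N = Q"
begin

definition act :: "'a \<Rightarrow> ('i \<Rightarrow> real) \<Rightarrow> 'i \<Rightarrow> real" where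
  "act t q = (\<lambda>i. q (\<pi> t i))"

lemma act_in: "t \<in> carrier G \<Longrightarrow> q \<in> Q \<Longrightarrow> act t q \<in> Q"
  unfolding act_def by (rule maps_Q)

lemma act_one: "q \<in> Q \<Longrightarrow> act \<one> q = q"
  by (simp add: act_def one_Q)

lemma act_mult: "s \<in> carrier G \<Longrightarrow> t \<in> carrier G \<Longrightarrow> q \<in> Q \<Longrightarrow> act (s \<otimes> t) q = act s (act t q)"
  by (simp add: act_def mult_Q)

lemma continuous_on_act: "continuous_on S (act t)"
  unfolding act_def by (intro continuous_on_coordinatewise_then_product continuous_on_coordinate)

lemma continuous_on_comp_act:
  assumes "continuous_on Q f" "t \<in> carrier G"
  shows "continuous_on Q (\<lambda>q. f (act t q))"
  by (rule continuous_on_compose2[OF assms(1) continuous_on_act]) (use act_in assms(2) in blast)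

text \<open>The closed convex hull of the orbit of \<open>L\<close>, as an intersection of half-spaces.\<close>

definition orbit_hull :: "((('i \<Rightarrow> real) \<Rightarrow> real) \<Rightarrow> real) \<Rightarrow> ((('i \<Rightarrow> real) \<Rightarrow> real) \<Rightarrow> real) set" where
  "orbit_hull L = {M \<in> states (top_of_set Q). \<forall>f c. continuous_on Q f \<longrightarrow>
     (\<forall>t\<in>carrier G. c \<le> L (\<lambda>q. f (act t q))) \<longrightarrow> c \<le> M f}"

text \<open>\<open>barycentre\<close> is continuous, affine and equivariant, so the image of the
  hull inherits all that \<open>irreducible_Q\<close> asks for; it lies in \<open>Q\<close> by
  \<open>barycentre_in\<close>.\<close>

lemma barycentre_orbit_hull:
  assumes L: "L \<in> states (top_of_set Q)"
  shows "barycentre ` orbit_hull L = Q"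
proof (rule irreducible_Q)
  have ci: "continuous_on Q (\<lambda>q. q i)" for i by (rule continuous_on_coordinate)
  have oh: "orbit_hull L = states (top_of_set Q) \<inter> {M. \<forall>f c. continuous_on Q f \<longrightarrow>
     (\<forall>t\<in>carrier G. c \<le> L (\<lambda>q. f (act t q))) \<longrightarrow> c \<le> M f}"
    by (auto simp: orbit_hull_def)
  have "compact (orbit_hull L)"
    unfolding oh
  proof (rule compact_Int_closed)
    show "compact (states (top_of_set Q))"
      by (intro compact_states compact_space_subtopology) (simp add: compact_Q)
    show "closed {M. \<forall>f c. continuous_on Q f \<longrightarrow>
     (\<forall>t\<in>carrier G. c \<le> L (\<lambda>q. f (act t q))) \<longrightarrow> c \<le> M f}"
      by (intro closed_Collect_all closed_Collect_imp open_Collect_const closed_Collect_le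
          continuous_intros)
  qed
  then have "compact (barycentre ` orbit_hull L)"
    by (rule compact_continuous_image[rotated])
      (auto simp: barycentre_def[abs_def] intro!: continuous_on_coordinatewise_then_product continuous_on_coordinate)
  then show "closed (barycentre ` orbit_hull L)" by (rule compact_imp_closed_fun)
  show "barycentre ` orbit_hull L \<subseteq> Q"
    using barycentre_in[OF compact_Q convex_Q nonempty_Q] by (auto simp: orbit_hull_def)
  have "L \<in> orbit_hull L"
  proof -
    have "c \<le> L f" if "\<forall>t\<in>carrier G. c \<le> L (\<lambda>q. f (act t q))" for c f
    proof -
      have "c \<le> L (\<lambda>q. f (act \<one> q))" using that by simp
      also have "\<dots> = L f" by (rule states_cong[OF L]) (simp add: act_one)
      finally show ?thesis .
    qed
    then show ?thesis using L by (auto simp: orbit_hull_def)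
  qed
  then show "barycentre ` orbit_hull L \<noteq> {}" by blast
  show "convex_fun (barycentre ` orbit_hull L)"
    unfolding convex_fun_def
  proof (clarify)
    fix M N and u :: real assume M: "M \<in> orbit_hull L" and N: "N \<in> orbit_hull L" and u: "u \<in> {0..1}"
    have Ms: "M \<in> states (top_of_set Q)" and Ns: "N \<in> states (top_of_set Q)"
      using M N by (auto simp: orbit_hull_def)
    let ?K = "\<lambda>f. (1 - u) * M f + u * N f"
    have "?K \<in> states (top_of_set Q)"
    proof (rule statesI)
      fix f :: "('i \<Rightarrow> real) \<Rightarrow> real"
      assume f: "continuous_map (top_of_set Q) euclideanreal f" "\<And>x. x \<in> topspace (top_of_set Q) \<Longrightarrow> 0 \<le> f x"
      have "0 \<le> M f" "0 \<le> N f" by (rule states_nonneg[OF Ms f] states_nonneg[OF Ns f]; simp)+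
      then show "0 \<le> ?K f" using u by simp
    qed (simp_all add: states_add[OF Ms] states_add[OF Ns] states_cmult[OF Ms] states_cmult[OF Ns]
        states_one[OF Ms] states_one[OF Ns] states_eq_0[OF Ms] states_eq_0[OF Ns] algebra_simps)
    moreover have "c \<le> ?K f" if "continuous_on Q f" "\<forall>t\<in>carrier G. c \<le> L (\<lambda>q. f (act t q))" for f c
    proof -
      have "c \<le> M f" "c \<le> N f" using M N that by (auto simp: orbit_hull_def)
      then have "(1 - u) * c + u * c \<le> ?K f" using u by (intro add_mono mult_left_mono) auto
      then show ?thesis by (simp add: algebra_simps)
    qed
    ultimately have "?K \<in> orbit_hull L" by (simp add: orbit_hull_def)
    moreover have "(\<lambda>i. (1 - u) * barycentre M i + u * barycentre N i) = barycentre ?K"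
      by (simp add: barycentre_def)
    ultimately show "(\<lambda>i. (1 - u) * barycentre M i + u * barycentre N i) \<in> barycentre ` orbit_hull L"
      by simp
  qed
  fix s b assume s: "s \<in> carrier G" and "b \<in> barycentre ` orbit_hull L"
  then obtain M where M: "M \<in> orbit_hull L" "b = barycentre M" by blast
  have Ms: "M \<in> states (top_of_set Q)" using M by (auto simp: orbit_hull_def)
  \<comment> \<open>The translate of \<open>M\<close> by \<open>s\<close>. A lower bound for
    \<open>f\<close> over the whole orbit of \<open>L\<close> covers the translates by
    \<open>s \<otimes> t\<close>, so it is also one for the function \<open>f (act s q)\<close>, and
    \<open>M\<close> respects it.\<close>
  define N where "N f = (if continuous_on Q f then M (\<lambda>q. f (act s q)) else 0)" for f
  have cs: "continuous_on Q (\<lambda>q. f (act s q))" if "continuous_on Q f" for f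
    by (rule continuous_on_comp_act[OF that s])
  have "N \<in> states (top_of_set Q)"
  proof (rule statesI)
    fix f :: "('i \<Rightarrow> real) \<Rightarrow> real"
    assume f: "continuous_map (top_of_set Q) euclideanreal f" "\<And>x. x \<in> topspace (top_of_set Q) \<Longrightarrow> 0 \<le> f x"
    have "0 \<le> M (\<lambda>q. f (act s q))"
      by (rule states_nonneg[OF Ms]) (use f cs act_in s in auto)
    then show "0 \<le> N f" by (simp add: N_def)
  qed (simp_all add: N_def cs states_add[OF Ms] states_cmult[OF Ms] states_one[OF Ms]
      continuous_on_add continuous_on_mult_left)
  moreover have "c \<le> N f" if f: "continuous_on Q f" "\<forall>t\<in>carrier G. c \<le> L (\<lambda>q. f (act t q))" for f c
  proof -
    have "\<forall>t\<in>carrier G. c \<le> L (\<lambda>q. f (act s (act t q)))"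
    proof
      fix t assume t: "t \<in> carrier G"
      have "c \<le> L (\<lambda>q. f (act (s \<otimes> t) q))" using f(2) s t by simp
      also have "\<dots> = L (\<lambda>q. f (act s (act t q)))"
        by (rule states_cong[OF L]) (simp add: act_mult s t)
      finally show "c \<le> L (\<lambda>q. f (act s (act t q)))" .
    qed
    then have "c \<le> M (\<lambda>q. f (act s q))" using M(1) cs[OF f(1)] by (auto simp: orbit_hull_def)
    then show ?thesis using f(1) by (simp add: N_def)
  qed
  ultimately have "N \<in> orbit_hull L" by (simp add: orbit_hull_def)
  moreover have "(\<lambda>i. b (\<pi> s i)) = barycentre N"
    by (simp add: M(2) barycentre_def N_def ci act_def)
  ultimately show "(\<lambda>i. b (\<pi> s i)) \<in> barycentre ` orbit_hull L" by simp
qed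

text \<open>If every translate had mean at least \<open>e\<close>, this would be one of the
  half-space conditions defining \<open>orbit_hull L\<close>. The member \<open>M\<close> with
  barycentre \<open>z\<close> would satisfy it too, yet all variances of \<open>M\<close> vanish by
  \<open>extreme_point_representing_state\<close>.\<close>

lemma concentrating_translate:
  assumes z: "extreme_fun Q z" and L: "L \<in> states (top_of_set Q)" and J: "finite J" and e: "0 < e"
  shows "\<exists>t\<in>carrier G. L (\<lambda>q. sqdist_on J z (act t q)) < e"
proof (rule ccontr)
  assume "\<not> ?thesis"
  then have ge: "\<forall>t\<in>carrier G. e \<le> L (\<lambda>q. sqdist_on J z (act t q))" by (auto simp: not_less)
  have "z \<in> barycentre ` orbit_hull L"
    using z barycentre_orbit_hull[OF L] by (simp add: extreme_fun_def)
  then obtain M where M: "M \<in> orbit_hull L" "barycentre M = z" by blast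
  then have Ms: "M \<in> states (top_of_set Q)" by (simp add: orbit_hull_def)
  have "M (\<lambda>q. sqdist_on J z q) = (\<Sum>i\<in>J. M (\<lambda>q. (q i - z i)\<^sup>2))"
    unfolding sqdist_on_def by (rule states_sum[OF Ms J]) (auto intro!: continuous_intros)
  also have "\<dots> = 0"
    using extreme_point_representing_state[OF compact_Q convex_Q z Ms M(2)] by simp
  finally have "M (\<lambda>q. sqdist_on J z q) = 0" .
  moreover have "continuous_on Q (\<lambda>q. sqdist_on J z q)"
    by (intro continuous_on_sqdist_on continuous_on_id)
  ultimately have "e \<le> 0" using M(1) ge by (fastforce simp: orbit_hull_def)
  then show False using e by simp
qed

text \<open>Both properties are instances of \<open>concentrating_translate\<close>: evaluation at a
  point gives minimality, the average of two measures gives strong proximality. The maps are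
  restricted to \<open>Z\<close> because \<open>group_action\<close> demands extensional
  bijections.\<close>

lemma minimal_strongly_proximal_orbit_closure:
  assumes z: "extreme_fun Q z"
  defines "Z \<equiv> closure ((\<lambda>t. act t z) ` carrier G)"
  shows "minimal_strongly_proximal_flow G T (top_of_set Z) (\<lambda>t. restrict (act t) Z)"
proof -
  let ?O = "\<lambda>w. (\<lambda>t. act t w) ` carrier G"
  let ?X = "top_of_set Z" and ?\<psi> = "\<lambda>t. restrict (act t) Z"
  have zQ: "z \<in> Q" using z by (simp add: extreme_fun_def)
  have ZQ: "Z \<subseteq> Q"
    unfolding Z_def using compact_imp_closed_fun[OF compact_Q] zQ act_in by (intro closure_minimal) auto
  have cZ: "compact Z"
    using compact_Int_closed[OF compact_Q, of Z] ZQ by (simp add: Int_absorb1 Z_def)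
  have zZ: "z \<in> Z"
    unfolding Z_def by (rule subsetD[OF closure_subset]) (use act_one[OF zQ] in force)
  have closure_orbit: "act t q \<in> closure (?O w)" if "w \<in> Q" "t \<in> carrier G" "q \<in> closure (?O w)" for w t q
  proof -
    have "act t ` closure (?O w) \<subseteq> closure (?O w)"
    proof (rule image_closure_subset[OF continuous_on_act])
      show "act t ` ?O w \<subseteq> closure (?O w)"
        using that(1,2) by (auto intro!: subsetD[OF closure_subset] simp flip: act_mult)
    qed simp
    then show ?thesis using that by blast
  qed
  have actZ: "act t q \<in> Z" if "t \<in> carrier G" "q \<in> Z" for t q
    using closure_orbit[OF zQ] that unfolding Z_def by blast
  have flow: "flow G T ?X ?\<psi>"
  proof (intro flow.intro flow_axioms.intro)
    show "topological_group G T" by unfold_locales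
    show "group_action G (topspace ?X) ?\<psi>"
    proof (rule group_actionI)
      show "group G" by unfold_locales
    qed (use actZ act_one act_mult ZQ in auto)
    show "topspace ?X \<noteq> {}" using zZ by auto
    show "compact_space ?X" by (rule compact_space_subtopology) (simp add: cZ)
    show "Hausdorff_space ?X"
      by (rule Hausdorff_space_subtopology)
        (simp add: Hausdorff_space_product_topology flip: euclidean_product_topology)
    have "continuous_map (prod_topology T ?X) (product_topology (\<lambda>_. euclideanreal) UNIV)
        (\<lambda>p. act (fst p) (snd p))"
      unfolding continuous_map_componentwise_UNIV
    proof
      fix i
      have "continuous_map ?X (top_of_set Q) (\<lambda>x. x)"
        using ZQ by (auto simp: continuous_map_in_subtopology continuous_on_id)
      then have "continuous_map (prod_topology T ?X) (prod_topology T (top_of_set Q)) (\<lambda>p. (fst p, snd p))"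
        by (intro continuous_map_pairedI continuous_map_fst
            continuous_map_compose[OF continuous_map_snd, unfolded o_def])
      from continuous_map_compose[OF this continuous_Q[of i]]
      show "continuous_map (prod_topology T ?X) euclidean (\<lambda>p. act (fst p) (snd p) i)"
        by (simp add: o_def act_def case_prod_beta)
    qed
    then have "continuous_map (prod_topology T ?X) ?X (\<lambda>p. act (fst p) (snd p))"
      using actZ
      by (auto simp: continuous_map_in_subtopology topspace_eq_carrier euclidean_product_topology)
    then show "continuous_map (prod_topology T ?X) ?X (\<lambda>(g, x). ?\<psi> g x)"
      by (rule continuous_map_eq) auto
  qed
  interpret Z: flow G T ?X ?\<psi> by (rule flow)
  have "minimal_action G ?X ?\<psi>"
    unfolding minimal_action_def
  proof
    fix w assume "w \<in> topspace ?X"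
    then have wZ: "w \<in> Z" by simp
    then have wQ: "w \<in> Q" using ZQ by blast
    \<comment> \<open>For evaluation at \<open>w\<close>, concentration at \<open>z\<close> says
      that the orbit of \<open>w\<close> comes arbitrarily close to \<open>z\<close>.\<close>
    define L where "L f = (if continuous_on Q f then f w else 0)" for f :: "('i \<Rightarrow> real) \<Rightarrow> real"
    have L: "L \<in> states (top_of_set Q)"
      by (rule statesI) (auto simp: L_def wQ continuous_on_add continuous_on_mult_left)
    have "z \<in> closure (?O w)"
      unfolding closure_iff_nhds_not_empty
    proof (intro allI impI)
      fix A U :: "('i \<Rightarrow> real) set" assume U: "U \<subseteq> A" "open U" "z \<in> U"
      obtain J e where J: "finite J" "0 < e" "\<And>q. sqdist_on J z q < e \<Longrightarrow> q \<in> U"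
        using open_contains_sqdist_ball[OF U(2,3)] by metis
      obtain t where t: "t \<in> carrier G" "L (\<lambda>q. sqdist_on J z (act t q)) < e"
        using concentrating_translate[OF z L J(1,2)] by blast
      have "continuous_on Q (\<lambda>q. sqdist_on J z (act t q))"
        by (intro continuous_on_sqdist_on continuous_on_act)
      then have "act t w \<in> U" using t(2) J(3) by (simp add: L_def)
      then show "?O w \<inter> A \<noteq> {}" using t(1) U(1) by blast
    qed
    then have "?O z \<subseteq> closure (?O w)" using closure_orbit[OF wQ] by blast
    then have "Z \<subseteq> closure (?O w)" unfolding Z_def by (rule closure_minimal) simp
    moreover have "orbit G ?\<psi> w = ?O w" using wZ by (auto simp: orbit_def)
    moreover have "?O w \<subseteq> Z" using wZ actZ by blast
    ultimately show "?X closure_of (orbit G ?\<psi> w) = topspace ?X"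
      by (simp add: closure_of_subtopology Int_absorb1 Int_absorb2)
  qed
  moreover have "strongly_proximal_action G ?X ?\<psi>"
    unfolding strongly_proximal_action_def proximal_action_def topspace_weak_star
  proof (intro ballI)
    fix \<mu> \<nu> assume \<mu>: "\<mu> \<in> regular_prob_measures ?X" and \<nu>: "\<nu> \<in> regular_prob_measures ?X"
    note int = integrable_regular_prob_measure[OF Z.compact_flow_space]
    note D\<mu> = regular_prob_measuresD[OF \<mu>] and D\<nu> = regular_prob_measuresD[OF \<nu>]
    interpret \<mu>: prob_space \<mu> by (rule D\<mu>)
    interpret \<nu>: prob_space \<nu> by (rule D\<nu>)
    have int\<mu>: "integrable \<mu> f" and int\<nu>: "integrable \<nu> f" if "continuous_on Q f" for f :: "('i \<Rightarrow> real) \<Rightarrow> real"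
      using int[OF _ \<mu>, of f] int[OF _ \<nu>, of f] continuous_on_subset[OF that ZQ] by auto
    \<comment> \<open>Measures on \<open>Z\<close> are read as states on the larger set
      \<open>Q\<close>. Averaging makes one translate concentrate both of them.\<close>
    define L where "L f = (if continuous_on Q f then ((\<integral>x. f x \<partial>\<mu>) + (\<integral>x. f x \<partial>\<nu>)) / 2 else 0)"
      for f :: "('i \<Rightarrow> real) \<Rightarrow> real"
    have L: "L \<in> states (top_of_set Q)"
    proof (rule statesI)
      fix f :: "('i \<Rightarrow> real) \<Rightarrow> real"
      assume f: "continuous_map (top_of_set Q) euclideanreal f" "\<And>x. x \<in> topspace (top_of_set Q) \<Longrightarrow> 0 \<le> f x"
      have "0 \<le> (\<integral>x. f x \<partial>\<mu>)" "0 \<le> (\<integral>x. f x \<partial>\<nu>)"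
        using f(2) ZQ D\<mu>(2) D\<nu>(2) by (auto intro!: integral_nonneg_AE AE_I2)
      then show "0 \<le> L f" by (simp add: L_def)
    qed (auto simp: L_def int\<mu> int\<nu> continuous_on_add continuous_on_mult_left \<mu>.prob_space \<nu>.prob_space
        add_divide_distrib distrib_left)
    define A where "A p = {t \<in> carrier G. L (\<lambda>q. sqdist_on (fst p) z (act t q)) < snd p}"
      for p :: "'i set \<times> real"
    let ?B = "{J. finite J} \<times> {0<..} :: ('i set \<times> real) set"
    \<comment> \<open>The net of concentrating translates. The sets \<open>A (J, d)\<close> form a
      filter base because \<open>sqdist_on\<close> grows with \<open>J\<close>: take unions of the
      \<open>J\<close> and minima of the \<open>d\<close>.\<close>
    define F where "F = (INF p\<in>?B. principal (A p))"
    have cont: "continuous_on Q (\<lambda>q. sqdist_on J z (act t q))" for J t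
      by (intro continuous_on_sqdist_on continuous_on_act)
    have ev: "eventually P F \<longleftrightarrow> (\<exists>p\<in>?B. \<forall>t\<in>A p. P t)" for P
      unfolding F_def eventually_principal[symmetric]
    proof (rule eventually_INF_base)
      show "?B \<noteq> {}" by (auto intro!: exI[of _ 1])
      fix p p' assume "p \<in> ?B" "p' \<in> ?B"
      then obtain J d J' d' where p: "p = (J, d)" "p' = (J', d')" "finite J" "finite J'" "0 < d" "0 < d'"
        by auto
      have mono: "L (\<lambda>q. sqdist_on I z (act t q)) \<le> L (\<lambda>q. sqdist_on (J \<union> J') z (act t q))"
        if "I \<subseteq> J \<union> J'" for I t
        by (rule states_mono[OF L]) (use cont that p in \<open>auto intro!: sqdist_on_mono\<close>)
      have "A (J \<union> J', min d d') \<subseteq> A p \<inter> A p'"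
      proof
        fix t assume "t \<in> A (J \<union> J', min d d')"
        moreover have "L (\<lambda>q. sqdist_on J z (act t q)) \<le> L (\<lambda>q. sqdist_on (J \<union> J') z (act t q))"
          "L (\<lambda>q. sqdist_on J' z (act t q)) \<le> L (\<lambda>q. sqdist_on (J \<union> J') z (act t q))"
          by (rule mono, blast)+
        ultimately show "t \<in> A p \<inter> A p'" unfolding A_def p by auto
      qed
      then show "\<exists>x\<in>?B. principal (A x) \<le> inf (principal (A p)) (principal (A p'))"
        using p by (intro bexI[of _ "(J \<union> J', min d d')"]) auto
    qed
    have A_ne: "A p \<noteq> {}" if "p \<in> ?B" for p
      using that concentrating_translate[OF z L, of "fst p" "snd p"] by (auto simp: A_def)
    have F_ne: "F \<noteq> bot"
      unfolding trivial_limit_def ev using A_ne by blast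
    have F_carrier: "\<forall>\<^sub>F t in F. t \<in> carrier G"
      unfolding ev by (intro bexI[of _ "({}, 1)"]) (auto simp: A_def)
    let ?d = "return (borel_on ?X) z"
    \<comment> \<open>Stated for any measure dominated by \<open>2 * L\<close>, so that \<mu> and
      \<nu> converge to the same limit along the same filter.\<close>
    have lim: "limitin (weak_star ?X) (\<lambda>t. measure_action ?X ?\<psi> t \<rho>) ?d F"
      if \<rho>: "\<rho> \<in> regular_prob_measures ?X"
        and le: "\<And>f. continuous_on Q f \<Longrightarrow> (\<And>q. q \<in> Z \<Longrightarrow> 0 \<le> f q) \<Longrightarrow> (\<integral>x. f x \<partial>\<rho>) \<le> 2 * L f" for \<rho>
      unfolding limitin_weak_star
    proof (intro conjI allI impI)
      note D\<rho> = regular_prob_measuresD[OF \<rho>]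
      interpret \<rho>: prob_space \<rho> by (rule D\<rho>)
      show "?d \<in> regular_prob_measures ?X"
        by (rule return_regular_prob_measures[OF Z.Hausdorff_flow_space]) (simp add: zZ)
      show "\<forall>\<^sub>F t in F. measure_action ?X ?\<psi> t \<rho> \<in> regular_prob_measures ?X"
        by (rule eventually_mono[OF F_carrier]) (rule Z.measure_action_in[OF _ \<rho>])
      fix f :: "('i \<Rightarrow> real) \<Rightarrow> real" assume f: "continuous_map ?X euclideanreal f"
      have fz: "(\<integral>x. f x \<partial>?d) = f z"
        using borel_measurable_borel_on[OF f] zZ by (intro integral_return) auto
      show "((\<lambda>t. \<integral>x. f x \<partial>measure_action ?X ?\<psi> t \<rho>) \<longlongrightarrow> (\<integral>x. f x \<partial>?d)) F"
        unfolding fz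
      proof (rule tendstoI)
        fix e :: real assume e: "0 < e"
        have "continuous_on Z f" using f by simp
        then obtain J C where J: "finite J" "0 < C"
          and dom: "\<And>q. q \<in> Z \<Longrightarrow> \<bar>f q - f z\<bar> \<le> e / 2 + C * sqdist_on J z q"
          using continuous_dominated_by_sqdist[OF cZ _ zZ, of f "e / 2"] e by auto
        \<comment> \<open>The factor 2 from the domination turns this bound into
          \<open>C * (2 * (e / (4 * C))) = e / 2\<close>, the other half of the error.\<close>
        let ?p = "(J, e / (4 * C))"
        have "\<bar>(\<integral>x. f x \<partial>measure_action ?X ?\<psi> t \<rho>) - f z\<bar> < e" if t: "t \<in> A ?p" for t
        proof -
          have tG: "t \<in> carrier G" and small: "L (\<lambda>q. sqdist_on J z (act t q)) < e / (4 * C)"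
            using t by (auto simp: A_def)
          have ft: "continuous_map ?X euclideanreal (\<lambda>x. f (?\<psi> t x))"
            using continuous_map_compose[OF Z.continuous_map_action[OF tG] f] by (simp add: o_def)
          have st: "continuous_map ?X euclideanreal (\<lambda>x. sqdist_on J z (act t x))"
            using continuous_on_subset[OF cont ZQ] by simp
          note i1 = int[OF ft \<rho>] and i2 = int[OF st \<rho>]
          have "\<bar>(\<integral>x. f x \<partial>measure_action ?X ?\<psi> t \<rho>) - f z\<bar> = \<bar>\<integral>x. f (?\<psi> t x) - f z \<partial>\<rho>\<bar>"
            using Z.integral_measure_action[OF tG \<rho> f] i1 by (simp add: \<rho>.prob_space)
          also have "\<dots> \<le> (\<integral>x. \<bar>f (?\<psi> t x) - f z\<bar> \<partial>\<rho>)" by (rule integral_abs_bound)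
          also have "\<dots> \<le> (\<integral>x. e / 2 + C * sqdist_on J z (act t x) \<partial>\<rho>)"
          proof (rule integral_mono)
            show "integrable \<rho> (\<lambda>x. \<bar>f (?\<psi> t x) - f z\<bar>)" using i1 by auto
            show "integrable \<rho> (\<lambda>x. e / 2 + C * sqdist_on J z (act t x))" using i2 by auto
            show "\<bar>f (?\<psi> t x) - f z\<bar> \<le> e / 2 + C * sqdist_on J z (act t x)" if "x \<in> space \<rho>" for x
              using that dom actZ tG D\<rho>(2) by auto
          qed
          also have "\<dots> = e / 2 + C * (\<integral>x. sqdist_on J z (act t x) \<partial>\<rho>)"
            using i2 by (simp add: \<rho>.prob_space)
          also have "\<dots> \<le> e / 2 + C * (2 * L (\<lambda>q. sqdist_on J z (act t q)))"
            using J(2) by (intro add_left_mono mult_left_mono le cont sqdist_on_nonneg) auto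
          also have "\<dots> < e / 2 + C * (2 * (e / (4 * C)))"
            using J(2) small by (intro add_strict_left_mono mult_strict_left_mono) auto
          also have "\<dots> = e" using J(2) by (simp add: field_simps)
          finally show ?thesis .
        qed
        moreover have "?p \<in> ?B" using J e by simp
        ultimately show "\<forall>\<^sub>F t in F. dist (\<integral>x. f x \<partial>measure_action ?X ?\<psi> t \<rho>) (f z) < e"
          unfolding ev dist_real_def by blast
      qed
    qed
    have "limitin (weak_star ?X) (\<lambda>t. measure_action ?X ?\<psi> t \<mu>) ?d F"
    proof (rule lim[OF \<mu>])
      fix f :: "('i \<Rightarrow> real) \<Rightarrow> real" assume f: "continuous_on Q f" "\<And>q. q \<in> Z \<Longrightarrow> 0 \<le> f q"
      have "0 \<le> (\<integral>x. f x \<partial>\<nu>)" using f(2) D\<nu>(2) by (auto intro!: integral_nonneg_AE AE_I2)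
      then show "(\<integral>x. f x \<partial>\<mu>) \<le> 2 * L f" using f(1) by (simp add: L_def)
    qed
    moreover have "limitin (weak_star ?X) (\<lambda>t. measure_action ?X ?\<psi> t \<nu>) ?d F"
    proof (rule lim[OF \<nu>])
      fix f :: "('i \<Rightarrow> real) \<Rightarrow> real" assume f: "continuous_on Q f" "\<And>q. q \<in> Z \<Longrightarrow> 0 \<le> f q"
      have "0 \<le> (\<integral>x. f x \<partial>\<mu>)" using f(2) D\<mu>(2) by (auto intro!: integral_nonneg_AE AE_I2)
      then show "(\<integral>x. f x \<partial>\<nu>) \<le> 2 * L f" using f(1) by (simp add: L_def)
    qed
    ultimately show "\<exists>F w. F \<noteq> bot \<and> (\<forall>\<^sub>F t in F. t \<in> carrier G) \<and>
        limitin (weak_star ?X) (\<lambda>t. measure_action ?X ?\<psi> t \<mu>) w F \<and>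
        limitin (weak_star ?X) (\<lambda>t. measure_action ?X ?\<psi> t \<nu>) w F"
      using F_ne F_carrier by blast
  qed
  ultimately show ?thesis using flow unfolding minimal_strongly_proximal_flow_def by blast
qed

end


section \<open>Non-amenable groups\<close>

lemma convex_states: "convex_fun (states X)"
  unfolding convex_fun_def
proof (intro ballI)
  fix M N and u :: real assume M: "M \<in> states X" and N: "N \<in> states X" and u: "u \<in> {0..1}"
  show "(\<lambda>f. (1 - u) * M f + u * N f) \<in> states X"
  proof (rule statesI)
    fix f :: "'a \<Rightarrow> real"
    assume f: "continuous_map X euclideanreal f" "\<And>x. x \<in> topspace X \<Longrightarrow> 0 \<le> f x"
    have "0 \<le> M f" "0 \<le> N f" by (rule states_nonneg[OF M f] states_nonneg[OF N f]; simp)+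
    then show "0 \<le> (1 - u) * M f + u * N f" using u by simp
  qed (simp_all add: states_add[OF M] states_add[OF N] states_cmult[OF M] states_cmult[OF N]
      states_one[OF M] states_one[OF N] states_eq_0[OF M] states_eq_0[OF N] algebra_simps)
qed

lemma evaluation_state:
  assumes "x \<in> topspace X"
  shows "(\<lambda>f. if continuous_map X euclideanreal f then f x else 0) \<in> states X"
  by (rule statesI) (use assms in \<open>auto simp: continuous_map_add continuous_map_real_mult_left\<close>)

section \<open>The action of the group on states\<close>

context flow
begin

text \<open>The implication from left to right is what lets a translate of a state again take the
  value 0 at discontinuous functions.\<close>

lemma continuous_comp_action_iff:
  fixes f :: "'c \<Rightarrow> real"
  assumes t: "t \<in> carrier G"
  shows "continuous_map X euclideanreal (\<lambda>x. f (\<phi> t x)) \<longleftrightarrow> continuous_map X euclideanreal f"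
proof
  assume "continuous_map X euclideanreal f"
  then show "continuous_map X euclideanreal (\<lambda>x. f (\<phi> t x))"
    using continuous_map_compose[OF continuous_map_action[OF t]] by (simp add: o_def)
next
  assume "continuous_map X euclideanreal (\<lambda>x. f (\<phi> t x))"
  then have "continuous_map X euclideanreal ((\<lambda>x. f (\<phi> t x)) \<circ> \<phi> (inv t))"
    using t by (intro continuous_map_compose[OF continuous_map_action]) auto
  then show "continuous_map X euclideanreal f"
    by (rule continuous_map_eq) (simp add: action_inv t)
qed

lemma translate_state:
  assumes t: "t \<in> carrier G" and L: "L \<in> states X"
  shows "(\<lambda>f. L (\<lambda>x. f (\<phi> t x))) \<in> states X"
proof (rule statesI)
  fix f :: "'c \<Rightarrow> real"
  assume "continuous_map X euclideanreal f" "\<And>x. x \<in> topspace X \<Longrightarrow> 0 \<le> f x"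
  then show "0 \<le> L (\<lambda>x. f (\<phi> t x))"
    by (intro states_nonneg[OF L]) (use t action_in in \<open>auto simp: continuous_comp_action_iff\<close>)
qed (simp_all add: continuous_comp_action_iff t states_add[OF L] states_cmult[OF L]
    states_one[OF L] states_eq_0[OF L])

text \<open>By joint continuity the pairs \<open>(t, x)\<close> with error below \<open>e\<close>
  form an open set containing \<open>{s}\<close> times the space. As the space is compact, the tube
  lemma yields a neighbourhood of \<open>s\<close> that works for all \<open>x\<close>.\<close>

lemma uniformly_close_translates:
  fixes f :: "'c \<Rightarrow> real"
  assumes f: "continuous_map X euclideanreal f" and s: "s \<in> carrier G" and e: "0 < e"
  obtains U where "openin T U" "s \<in> U"
    "\<And>t x. t \<in> U \<Longrightarrow> x \<in> topspace X \<Longrightarrow> \<bar>f (\<phi> t x) - f (\<phi> s x)\<bar> < e"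
proof -
  have "continuous_map (prod_topology T X) euclideanreal (\<lambda>p. f (\<phi> (fst p) (snd p)))"
    using continuous_map_compose[OF continuous_action f] by (simp add: o_def case_prod_beta)
  moreover have "continuous_map (prod_topology T X) euclideanreal (\<lambda>p. f (\<phi> s (snd p)))"
    using continuous_map_compose[OF continuous_map_snd, of X euclideanreal "\<lambda>x. f (\<phi> s x)" T]
      continuous_comp_action_iff[OF s] f by (simp add: o_def)
  ultimately have "continuous_map (prod_topology T X) euclideanreal
      (\<lambda>p. f (\<phi> (fst p) (snd p)) - f (\<phi> s (snd p)))"
    by (rule continuous_map_diff)
  from openin_continuous_map_preimage[OF this, of "{-e<..<e}"]
  have W: "openin (prod_topology T X) {p \<in> topspace (prod_topology T X).
      f (\<phi> (fst p) (snd p)) - f (\<phi> s (snd p)) \<in> {-e<..<e}}" (is "openin _ ?W") by simp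
  have "\<exists>U V. openin T U \<and> openin X V \<and> s \<in> U \<and> topspace X \<subseteq> V \<and> U \<times> V \<subseteq> ?W"
    by (rule tube_lemma_right[OF W])
      (use s e compact_flow_space in \<open>auto simp: topspace_eq_carrier compact_space_def\<close>)
  then obtain U V where U: "openin T U" "s \<in> U" "topspace X \<subseteq> V" "U \<times> V \<subseteq> ?W" by blast
  show ?thesis
  proof (rule that[OF U(1,2)])
    fix t x assume "t \<in> U" "x \<in> topspace X"
    then have "(t, x) \<in> ?W" using U(3,4) by blast
    then show "\<bar>f (\<phi> t x) - f (\<phi> s x)\<bar> < e" by (auto simp: abs_less_iff)
  qed
qed

text \<open>Moving \<open>t\<close> changes the function uniformly little, and states have norm 1,
  so that error is uniform in the state; moving the state with \<open>s\<close> fixed is a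
  coordinate change. Each part receives \<open>e / 2\<close>.\<close>

lemma continuous_translate_state:
  fixes f :: "'c \<Rightarrow> real"
  assumes Q: "Q \<subseteq> states X"
  shows "continuous_map (prod_topology T (top_of_set Q)) euclideanreal (\<lambda>(t, L). L (\<lambda>x. f (\<phi> t x)))"
proof (cases "continuous_map X euclideanreal f")
  case False
  have "L (\<lambda>x. f (\<phi> t x)) = 0" if "t \<in> carrier G" "L \<in> Q" for t L
    by (rule states_eq_0[of L X]) (use that False Q in \<open>auto simp: continuous_comp_action_iff\<close>)
  note 0 = this
  show ?thesis
  proof (rule continuous_map_eq[where f = "\<lambda>_. 0"])
    show "0 = (case p of (t, L) \<Rightarrow> L (\<lambda>x. f (\<phi> t x)))"
      if "p \<in> topspace (prod_topology T (top_of_set Q))" for p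
      using that 0[of "fst p" "snd p"] by (cases p) (simp add: topspace_eq_carrier)
  qed simp
next
  case True
  let ?P = "prod_topology T (top_of_set Q)"
  let ?g = "\<lambda>(t, L). L (\<lambda>x. f (\<phi> t x))"
  show ?thesis
    unfolding continuous_map_def
  proof (intro conjI allI impI)
    fix V :: "real set" assume V: "openin euclideanreal V"
    show "openin ?P {p \<in> topspace ?P. ?g p \<in> V}"
    proof (subst openin_subopen, intro ballI)
      fix p assume "p \<in> {p \<in> topspace ?P. ?g p \<in> V}"
      then obtain s L where p: "p = (s, L)" "s \<in> carrier G" "L \<in> Q" "L (\<lambda>x. f (\<phi> s x)) \<in> V"
        by (auto simp: topspace_eq_carrier)
      obtain e where e: "0 < e" "\<And>r. \<bar>r - L (\<lambda>x. f (\<phi> s x))\<bar> < e \<Longrightarrow> r \<in> V"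
        using V p(4) by (auto simp: open_dist dist_real_def)
      obtain U where U: "openin T U" "s \<in> U"
        "\<And>t x. t \<in> U \<Longrightarrow> x \<in> topspace X \<Longrightarrow> \<bar>f (\<phi> t x) - f (\<phi> s x)\<bar> < e / 2"
        using uniformly_close_translates[OF True p(2), of "e / 2"] e(1) by auto
      define W where "W = {M \<in> Q. M (\<lambda>x. f (\<phi> s x)) \<in> {L (\<lambda>x. f (\<phi> s x)) - e / 2<..<L (\<lambda>x. f (\<phi> s x)) + e / 2}}"
      have W: "openin (top_of_set Q) W"
        using openin_continuous_map_preimage[of "top_of_set Q" euclideanreal "\<lambda>M. M (\<lambda>x. f (\<phi> s x))"
            "{L (\<lambda>x. f (\<phi> s x)) - e / 2<..<L (\<lambda>x. f (\<phi> s x)) + e / 2}"]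
          continuous_on_coordinate[of Q "\<lambda>x. f (\<phi> s x)"]
        by (simp add: W_def)
      have sub: "M (\<lambda>x. f (\<phi> t x)) \<in> V" if t: "t \<in> U" and M: "M \<in> W" for t M
      proof -
        have tG: "t \<in> carrier G" using U(1) t openin_subset topspace_eq_carrier by blast
        have MS: "M \<in> states X" using M Q by (auto simp: W_def)
        have c: "continuous_map X euclideanreal (\<lambda>x. f (\<phi> t x))" "continuous_map X euclideanreal (\<lambda>x. f (\<phi> s x))"
          using True tG p(2) by (simp_all add: continuous_comp_action_iff)
        have "\<bar>M (\<lambda>x. f (\<phi> t x) - f (\<phi> s x))\<bar> \<le> e / 2"
          by (rule states_bounded[OF MS continuous_map_diff[OF c]]) (rule less_imp_le[OF U(3)[OF t]])
        then have "\<bar>M (\<lambda>x. f (\<phi> t x)) - M (\<lambda>x. f (\<phi> s x))\<bar> \<le> e / 2"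
          using states_diff[OF MS c] by simp
        moreover have "\<bar>M (\<lambda>x. f (\<phi> s x)) - L (\<lambda>x. f (\<phi> s x))\<bar> < e / 2"
          using M unfolding W_def mem_Collect_eq greaterThanLessThan_iff abs_less_iff by linarith
        ultimately show ?thesis by (intro e(2)) linarith
      qed
      have "openin ?P (U \<times> W)" using U(1) W by (simp add: openin_prod_Times_iff)
      moreover have "p \<in> U \<times> W" using p U(2) e(1) by (simp add: W_def)
      moreover have "U \<times> W \<subseteq> {p \<in> topspace ?P. ?g p \<in> V}"
        using sub openin_subset[OF U(1)] by (auto simp: W_def)
      ultimately show "\<exists>S. openin ?P S \<and> p \<in> S \<and> S \<subseteq> {p \<in> topspace ?P. ?g p \<in> V}" by blast
    qed
  qed auto
qed

lemma invariant_state_imp_invariant_measure: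
  assumes L: "L \<in> states X" and inv: "\<And>t f. t \<in> carrier G \<Longrightarrow> L (\<lambda>x. f (\<phi> t x)) = L f"
  shows "\<exists>\<mu>. invariant_measure G X \<phi> \<mu>"
proof -
  interpret S: compact_state X L
    by unfold_locales (rule compact_flow_space Hausdorff_flow_space L)+
  have "measure_action X \<phi> t S.state_measure = S.state_measure" if t: "t \<in> carrier G" for t
    using S.distr_state_measure[OF homeomorphic_maps_action[OF t]] inv[OF t] S.state_measure_in
    by (simp add: measure_action_def)
  then show ?thesis
    unfolding invariant_measure_def using S.state_measure_in by blast
qed

theorem nontrivial_minimal_strongly_proximal_flow:
  assumes no_inv: "\<nexists>\<mu>. invariant_measure G X \<phi> \<mu>"
  shows "\<exists>(Z :: (('c \<Rightarrow> real) \<Rightarrow> real) topology) \<psi>.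
    minimal_strongly_proximal_flow G T Z \<psi> \<and> (\<nexists>z. topspace Z = {z})"
proof -
  let ?\<pi> = "\<lambda>t f x. f (\<phi> t x) :: real"
  define P where "P N \<longleftrightarrow> closed N \<and> N \<noteq> {} \<and> N \<subseteq> states X \<and> convex_fun N \<and>
    (\<forall>t\<in>carrier G. \<forall>q\<in>N. (\<lambda>f. q (?\<pi> t f)) \<in> N)" for N
  have cS: "compact (states X)" by (rule compact_states[OF compact_flow_space])
  have "\<exists>Q. P Q \<and> (\<forall>N. P N \<longrightarrow> N \<subseteq> Q \<longrightarrow> N = Q)"
  proof (rule minimal_closed_set[OF cS, of P])
    obtain x where "x \<in> topspace X" using nonempty_space by blast
    from evaluation_state[OF this] have "states X \<noteq> {}" by auto
    then show "P (states X)"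
      by (simp add: P_def compact_imp_closed_fun[OF cS] convex_states translate_state)
    show "closed N \<and> N \<noteq> {} \<and> N \<subseteq> states X" if "P N" for N using that by (simp add: P_def)
    show "P (\<Inter>\<C>)" if C: "\<C> \<noteq> {}" "\<And>N. N \<in> \<C> \<Longrightarrow> P N" "\<Inter>\<C> \<noteq> {}" for \<C>
      unfolding P_def
    proof (intro conjI closed_Inter ballI)
      show "closed N" if "N \<in> \<C>" for N using C(2)[OF that] by (simp add: P_def)
      show "convex_fun (\<Inter>\<C>)"
        using C(2) unfolding convex_fun_def P_def by (meson InterE InterI)
      fix t q assume "t \<in> carrier G" "q \<in> \<Inter>\<C>"
      then show "(\<lambda>f. q (?\<pi> t f)) \<in> \<Inter>\<C>" using C(2) unfolding P_def by (meson InterE InterI)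
    next
      obtain N where "N \<in> \<C>" using C(1) by blast
      moreover from this have "N \<subseteq> states X" using C(2) by (simp add: P_def)
      ultimately show "\<Inter>\<C> \<subseteq> states X" by blast
    qed (rule C(3))
  qed
  then obtain Q where PQ: "P Q" and min: "\<forall>N. P N \<longrightarrow> N \<subseteq> Q \<longrightarrow> N = Q" by (elim exE conjE)
  have QS: "Q \<subseteq> states X" and Qc: "closed Q" "convex_fun Q" "Q \<noteq> {}"
    and Qinv: "\<And>t q. t \<in> carrier G \<Longrightarrow> q \<in> Q \<Longrightarrow> (\<lambda>f. q (?\<pi> t f)) \<in> Q"
    using PQ by (auto simp: P_def)
  have cQ: "compact Q" using compact_Int_closed[OF cS Qc(1)] QS by (simp add: Int_absorb1)
  interpret irreducible_affine_system G T Q ?\<pi>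
  proof unfold_locales
    \<comment> \<open>\<open>\<phi> \<one>\<close> is the identity only on
      \<open>topspace X\<close>, so \<open>?\<pi> \<one> f\<close> and \<open>f\<close> may differ
      elsewhere; \<open>states_cong\<close> ignores this.\<close>
    fix q f assume q: "q \<in> Q"
    show "q (?\<pi> \<one> f) = q f"
      by (rule states_cong[of q X]) (use q QS action_one in auto)
  next
    fix s t q f assume st: "s \<in> carrier G" "t \<in> carrier G" and q: "q \<in> Q"
    show "q (?\<pi> (s \<otimes> t) f) = q (?\<pi> t (?\<pi> s f))"
      by (rule states_cong[of q X]) (use q QS st composition_rule in auto)
  next
    fix N assume "closed N" "N \<subseteq> Q" "N \<noteq> {}" "convex_fun N"
      "\<And>t q. t \<in> carrier G \<Longrightarrow> q \<in> N \<Longrightarrow> (\<lambda>i. q (?\<pi> t i)) \<in> N"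
    then have "P N" using QS by (auto simp: P_def)
    then show "N = Q" using min \<open>N \<subseteq> Q\<close> by blast
  qed (use cQ Qc Qinv continuous_translate_state[OF QS] in auto)
  obtain z where z: "extreme_fun Q z" using extreme_fun_exists[OF cQ Qc(3)] by blast
  let ?Z = "closure ((\<lambda>t. act t z) ` carrier G)"
  have "\<nexists>w. ?Z = {w}"
  proof
    assume "\<exists>w. ?Z = {w}"
    then obtain w where "?Z = {w}" ..
    then have w: "act t z = w" if "t \<in> carrier G" for t
      using that closure_subset[of "(\<lambda>t. act t z) ` carrier G"] by blast
    have zQ: "z \<in> Q" using z by (simp add: extreme_fun_def)
    have "act t z = z" if "t \<in> carrier G" for t
      using w[OF that] w[OF one_closed] act_one[OF zQ] by simp
    then have "z (\<lambda>x. f (\<phi> t x)) = z f" if "t \<in> carrier G" for t f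
      using that unfolding act_def by metis
    then show False
      using invariant_state_imp_invariant_measure[of z] zQ QS no_inv by blast
  qed
  then show ?thesis
    using minimal_strongly_proximal_orbit_closure[OF z] by (metis topspace_euclidean_subtopology)
qed

end

section \<open>Isomorphic and twisted flows\<close>

lemma minimal_action_homeomorphic:
  assumes X: "flow G T X \<phi>" and Y: "flow G T Y \<psi>" and e: "homeomorphic_map X Y e"
    and equiv: "\<And>t x. t \<in> carrier G \<Longrightarrow> x \<in> topspace X \<Longrightarrow> e (\<phi> t x) = \<psi> t (e x)"
    and min: "minimal_action G X \<phi>"
  shows "minimal_action G Y \<psi>"
  unfolding minimal_action_def
proof
  interpret X: flow G T X \<phi> by (rule X)
  have im: "e ` topspace X = topspace Y" by (rule homeomorphic_imp_surjective_map[OF e])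
  fix y assume "y \<in> topspace Y"
  then obtain x where x: "x \<in> topspace X" "y = e x" using im by blast
  have "orbit G \<psi> y = e ` orbit G \<phi> x" using x equiv by (auto simp: orbit_def image_iff) metis
  moreover have "orbit G \<phi> x \<subseteq> topspace X" using x X.action_in by (auto simp: orbit_def)
  ultimately have "Y closure_of (orbit G \<psi> y) = e ` (X closure_of (orbit G \<phi> x))"
    using homeomorphic_map_closure_of[OF e] by simp
  then show "Y closure_of (orbit G \<psi> y) = topspace Y"
    using min x im by (simp add: minimal_action_def)
qed

text \<open>Measures are pulled back by \<open>d\<close>, made proximal on \<open>X\<close>, and
  their limit is pushed forward by \<open>e\<close>. Integrals of \<open>f\<close> on
  \<open>Y\<close> are integrals of \<open>f\<close> composed with \<open>e\<close> on
  \<open>X\<close>, so convergence carries over.\<close>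

lemma strongly_proximal_action_homeomorphic:
  assumes X: "flow G T X \<phi>" and Y: "flow G T Y \<psi>" and ed: "homeomorphic_maps X Y e d"
    and equiv: "\<And>t x. t \<in> carrier G \<Longrightarrow> x \<in> topspace X \<Longrightarrow> e (\<phi> t x) = \<psi> t (e x)"
    and sp: "strongly_proximal_action G X \<phi>"
  shows "strongly_proximal_action G Y \<psi>"
  unfolding strongly_proximal_action_def proximal_action_def topspace_weak_star
proof (intro ballI)
  interpret X: flow G T X \<phi> by (rule X)
  interpret Y: flow G T Y \<psi> by (rule Y)
  have ce: "continuous_map X Y e" and cd: "continuous_map Y X d"
    and e_d: "\<And>y. y \<in> topspace Y \<Longrightarrow> e (d y) = y"
    and d_in: "\<And>y. y \<in> topspace Y \<Longrightarrow> d y \<in> topspace X"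
    using ed by (auto simp: homeomorphic_maps_def continuous_map_def)
  have de: "homeomorphic_maps Y X d e" using ed homeomorphic_maps_sym by blast
  let ?p = "\<lambda>\<mu>. distr \<mu> (borel_on X) d" and ?q = "\<lambda>\<theta>. distr \<theta> (borel_on Y) e"
  have p: "?p \<mu> \<in> regular_prob_measures X" if "\<mu> \<in> regular_prob_measures Y" for \<mu>
    by (rule distr_regular_prob_measures[OF de Y.Hausdorff_flow_space that])
  have lim: "limitin (weak_star Y) (\<lambda>t. measure_action Y \<psi> t \<mu>) (?q \<theta>) F"
    if \<mu>: "\<mu> \<in> regular_prob_measures Y" and F: "\<forall>\<^sub>F t in F. t \<in> carrier G"
      and l: "limitin (weak_star X) (\<lambda>t. measure_action X \<phi> t (?p \<mu>)) \<theta> F" for \<mu> \<theta> F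
    unfolding limitin_weak_star
  proof (intro conjI allI impI)
    have \<theta>: "\<theta> \<in> regular_prob_measures X" using l by (simp add: limitin_weak_star)
    show "?q \<theta> \<in> regular_prob_measures Y"
      by (rule distr_regular_prob_measures[OF ed X.Hausdorff_flow_space \<theta>])
    show "\<forall>\<^sub>F t in F. measure_action Y \<psi> t \<mu> \<in> regular_prob_measures Y"
      by (rule eventually_mono[OF F]) (rule Y.measure_action_in[OF _ \<mu>])
    fix f :: "'d \<Rightarrow> real" assume f: "continuous_map Y euclideanreal f"
    have fe: "continuous_map X euclideanreal (\<lambda>x. f (e x))"
      using continuous_map_compose[OF ce f] by (simp add: o_def)
    have eq: "(\<integral>x. f (e x) \<partial>measure_action X \<phi> t (?p \<mu>)) = (\<integral>y. f y \<partial>measure_action Y \<psi> t \<mu>)"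
      if t: "t \<in> carrier G" for t
    proof -
      have "(\<integral>x. f (e x) \<partial>measure_action X \<phi> t (?p \<mu>)) = (\<integral>x. f (e (\<phi> t x)) \<partial>?p \<mu>)"
        by (rule X.integral_measure_action[OF t p[OF \<mu>] fe])
      also have "\<dots> = (\<integral>y. f (e (\<phi> t (d y))) \<partial>\<mu>)"
        by (rule integral_distr_continuous[OF cd iffD2[OF X.continuous_comp_action_iff[OF t] fe] \<mu>])
      also have "\<dots> = (\<integral>y. f (\<psi> t y) \<partial>\<mu>)"
        by (rule Bochner_Integration.integral_cong)
          (simp_all add: regular_prob_measuresD(2)[OF \<mu>] equiv[OF t] d_in e_d)
      also have "\<dots> = (\<integral>y. f y \<partial>measure_action Y \<psi> t \<mu>)"
        by (rule Y.integral_measure_action[OF t \<mu> f, symmetric])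
      finally show ?thesis .
    qed
    have "((\<lambda>t. \<integral>x. f (e x) \<partial>measure_action X \<phi> t (?p \<mu>)) \<longlongrightarrow> (\<integral>x. f (e x) \<partial>\<theta>)) F"
      using l fe by (simp add: limitin_weak_star)
    then have "((\<lambda>t. \<integral>y. f y \<partial>measure_action Y \<psi> t \<mu>) \<longlongrightarrow> (\<integral>x. f (e x) \<partial>\<theta>)) F"
      by (rule Lim_transform_eventually) (rule eventually_mono[OF F eq])
    then show "((\<lambda>t. \<integral>y. f y \<partial>measure_action Y \<psi> t \<mu>) \<longlongrightarrow> (\<integral>y. f y \<partial>?q \<theta>)) F"
      using integral_distr_continuous[OF ce f \<theta>] by simp
  qed
  fix \<mu> \<nu> assume \<mu>: "\<mu> \<in> regular_prob_measures Y" and \<nu>: "\<nu> \<in> regular_prob_measures Y"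
  obtain F \<theta> where F: "F \<noteq> bot" "\<forall>\<^sub>F t in F. t \<in> carrier G"
    and "limitin (weak_star X) (\<lambda>t. measure_action X \<phi> t (?p \<mu>)) \<theta> F"
      "limitin (weak_star X) (\<lambda>t. measure_action X \<phi> t (?p \<nu>)) \<theta> F"
    using sp p[OF \<mu>] p[OF \<nu>]
    unfolding strongly_proximal_action_def proximal_action_def topspace_weak_star by blast
  then show "\<exists>F \<theta>. F \<noteq> bot \<and> (\<forall>\<^sub>F t in F. t \<in> carrier G) \<and>
      limitin (weak_star Y) (\<lambda>t. measure_action Y \<psi> t \<mu>) \<theta> F \<and>
      limitin (weak_star Y) (\<lambda>t. measure_action Y \<psi> t \<nu>) \<theta> F"
    using lim[OF \<mu> F(2)] lim[OF \<nu> F(2)] by blast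
qed

text \<open>This is how an arbitrary competitor is brought to the type on which universality is
  tested.\<close>

lemma minimal_strongly_proximal_flow_copy:
  fixes G :: "('g, 'm) monoid_scheme" and X :: "'x topology"
  assumes "minimal_strongly_proximal_flow G T X \<phi>"
  shows "\<exists>(Y :: 'g set set topology) \<psi> e.
    minimal_strongly_proximal_flow G T Y \<psi> \<and> homeomorphic_map X Y e \<and> factor_map G X \<phi> Y \<psi> e"
proof -
  have X: "flow G T X \<phi>" "minimal_action G X \<phi>" "strongly_proximal_action G X \<phi>"
    using assms by (auto simp: minimal_strongly_proximal_flow_def)
  obtain Y :: "'g set set topology" and \<psi> e
    where Y: "flow G T Y \<psi>" "homeomorphic_map X Y e" "factor_map G X \<phi> Y \<psi> e"
    using minimal_flow_copy[OF X(1,2)] by blast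
  obtain d where d: "homeomorphic_maps X Y e d" using Y(2) homeomorphic_map_maps by blast
  have equiv: "\<And>t x. t \<in> carrier G \<Longrightarrow> x \<in> topspace X \<Longrightarrow> e (\<phi> t x) = \<psi> t (e x)"
    using Y(3) by (simp add: factor_map_def)
  have "minimal_strongly_proximal_flow G T Y \<psi>"
    unfolding minimal_strongly_proximal_flow_def
    using Y(1) minimal_action_homeomorphic[OF X(1) Y(1,2) equiv X(2)]
      strongly_proximal_action_homeomorphic[OF X(1) Y(1) d equiv X(3)] by blast
  then show ?thesis using Y by blast
qed

text \<open>\<open>a\<close> permutes the group, so orbits stay the same, and a net for the old
  action becomes one for the new action after applying the inverse of \<open>a\<close>. Continuity
  of \<open>a\<close> gives joint continuity.\<close>

lemma minimal_strongly_proximal_flow_twist: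
  fixes G :: "('g, 'm) monoid_scheme" and X :: "'x topology"
  assumes msp: "minimal_strongly_proximal_flow G T X \<phi>" and a: "a \<in> topological_auto G T"
  shows "minimal_strongly_proximal_flow G T X (\<lambda>t. \<phi> (a t))"
proof -
  have X: "flow G T X \<phi>" "minimal_action G X \<phi>" "strongly_proximal_action G X \<phi>"
    using msp by (auto simp: minimal_strongly_proximal_flow_def)
  interpret X: flow G T X \<phi> by (rule X)
  have hom: "a \<in> hom G G" and bij: "bij_betw a (carrier G) (carrier G)" and ca: "continuous_map T T a"
    using a homeomorphic_imp_continuous_map by (auto simp: topological_auto_def auto_def Bij_def)
  have aG: "a t \<in> carrier G" if "t \<in> carrier G" for t using hom that by (rule hom_in_carrier)
  have "flow G T X (\<lambda>t. \<phi> (a t))"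
  proof (intro flow.intro flow_axioms.intro)
    show "topological_group G T" by unfold_locales
    show "group_action G (topspace X) (\<lambda>t. \<phi> (a t))"
    proof (rule group_actionI)
      show "group G" by (rule X.is_group)
      show "\<phi> (a g) \<in> extensional (topspace X)" if "g \<in> carrier G" for g
        using X.bij_prop0[OF aG[OF that]] by (simp add: Bij_def)
      show "\<phi> (a \<one>\<^bsub>G\<^esub>) x = x" if "x \<in> topspace X" for x
        using hom_one[OF hom X.is_group X.is_group] X.action_one[OF that] by simp
      show "\<phi> (a (g \<otimes>\<^bsub>G\<^esub> h)) x = \<phi> (a g) (\<phi> (a h) x)"
        if "g \<in> carrier G" "h \<in> carrier G" "x \<in> topspace X" for g h x
        using that hom_mult[OF hom] aG X.composition_rule by simp
    qed (use X.action_in aG in auto)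
    have "continuous_map (prod_topology T X) (prod_topology T X) (\<lambda>p. (a (fst p), snd p))"
      by (intro continuous_map_pairedI continuous_map_snd
          continuous_map_compose[OF continuous_map_fst ca, unfolded o_def])
    from continuous_map_compose[OF this X.continuous_action]
    show "continuous_map (prod_topology T X) X (\<lambda>(g, x). \<phi> (a g) x)"
      by (simp add: o_def case_prod_unfold)
  qed (rule X.nonempty_space X.compact_flow_space X.Hausdorff_flow_space)+
  moreover have "minimal_action G X (\<lambda>t. \<phi> (a t))"
  proof -
    have "orbit G (\<lambda>t. \<phi> (a t)) x = orbit G \<phi> x" for x
    proof -
      have "orbit G (\<lambda>t. \<phi> (a t)) x = (\<lambda>t. \<phi> t x) ` (a ` carrier G)" by (auto simp: orbit_def)
      also have "\<dots> = orbit G \<phi> x" using bij by (auto simp: bij_betw_def orbit_def)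
      finally show ?thesis .
    qed
    then show ?thesis using X(2) by (simp add: minimal_action_def)
  qed
  moreover have "strongly_proximal_action G X (\<lambda>t. \<phi> (a t))"
    unfolding strongly_proximal_action_def proximal_action_def
  proof (intro ballI)
    fix \<mu> \<nu> assume "\<mu> \<in> topspace (weak_star X)" "\<nu> \<in> topspace (weak_star X)"
    then obtain F \<theta> where F: "F \<noteq> bot" "\<forall>\<^sub>F t in F. t \<in> carrier G"
      and l: "limitin (weak_star X) (\<lambda>t. measure_action X \<phi> t \<mu>) \<theta> F"
        "limitin (weak_star X) (\<lambda>t. measure_action X \<phi> t \<nu>) \<theta> F"
      using X(3) unfolding strongly_proximal_action_def proximal_action_def by blast
    let ?b = "inv_into (carrier G) a"
    have b: "?b t \<in> carrier G" "a (?b t) = t" if "t \<in> carrier G" for t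
      using that bij by (auto simp: bij_betw_def intro: inv_into_into f_inv_into_f)
    have lim: "limitin (weak_star X) (\<lambda>t. measure_action X (\<lambda>t. \<phi> (a t)) t \<rho>) \<theta> (filtermap ?b F)"
      if "limitin (weak_star X) (\<lambda>t. measure_action X \<phi> t \<rho>) \<theta> F" for \<rho>
      unfolding limitin_def
    proof (intro conjI allI impI)
      show "\<theta> \<in> topspace (weak_star X)" using that by (simp add: limitin_def)
      fix U assume "openin (weak_star X) U \<and> \<theta> \<in> U"
      then have "\<forall>\<^sub>F t in F. measure_action X \<phi> t \<rho> \<in> U" using that by (simp add: limitin_def)
      with F(2) show "\<forall>\<^sub>F t in filtermap ?b F. measure_action X (\<lambda>t. \<phi> (a t)) t \<rho> \<in> U"
        unfolding eventually_filtermap by eventually_elim (simp add: b measure_action_def)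
    qed
    have "\<forall>\<^sub>F t in filtermap ?b F. t \<in> carrier G"
      unfolding eventually_filtermap by (rule eventually_mono[OF F(2) b(1)])
    then show "\<exists>F \<theta>. F \<noteq> bot \<and> (\<forall>\<^sub>F t in F. t \<in> carrier G) \<and>
        limitin (weak_star X) (\<lambda>t. measure_action X (\<lambda>t. \<phi> (a t)) t \<mu>) \<theta> F \<and>
        limitin (weak_star X) (\<lambda>t. measure_action X (\<lambda>t. \<phi> (a t)) t \<nu>) \<theta> F"
      using lim[OF l(1)] lim[OF l(2)] F(1) by (meson filtermap_bot_iff)
  qed
  ultimately show ?thesis unfolding minimal_strongly_proximal_flow_def by blast
qed

section \<open>The kernel of the action\<close>

lemma (in flow) subgroup_kernel: "subgroup {g \<in> carrier G. \<forall>x\<in>topspace X. \<phi> g x = x} G"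
proof (rule subgroupI)
  show "{g \<in> carrier G. \<forall>x\<in>topspace X. \<phi> g x = x} \<noteq> {}" using action_one by blast
  show "inv g \<in> {g \<in> carrier G. \<forall>x\<in>topspace X. \<phi> g x = x}"
    if "g \<in> {g \<in> carrier G. \<forall>x\<in>topspace X. \<phi> g x = x}" for g
    using that action_inv(2)[of g] by auto
qed (use composition_rule in auto)

lemma (in flow) closedin_kernel: "closedin T {g \<in> carrier G. \<forall>x\<in>topspace X. \<phi> g x = x}"
proof -
  have "closedin T {g \<in> topspace T. \<phi> g x \<in> {x}}" if x: "x \<in> topspace X" for x
  proof (rule closedin_continuous_map_preimage)
    have "continuous_map T (prod_topology T X) (\<lambda>g. (g, x))"
      using x by (intro continuous_map_pairedI) auto
    from continuous_map_compose[OF this continuous_action]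
    show "continuous_map T X (\<lambda>g. \<phi> g x)" by (simp add: o_def)
    show "closedin X {x}" by (rule closedin_Hausdorff_singleton[OF Hausdorff_flow_space x])
  qed
  then have "closedin T (\<Inter>x\<in>topspace X. {g \<in> topspace T. \<phi> g x \<in> {x}})"
    using nonempty_space by (intro closedin_INT) auto
  also have "(\<Inter>x\<in>topspace X. {g \<in> topspace T. \<phi> g x \<in> {x}}) =
      {g \<in> carrier G. \<forall>x\<in>topspace X. \<phi> g x = x}"
    using nonempty_space topspace_eq_carrier by auto
  finally show ?thesis .
qed

theorem theorem2p8:
  fixes G :: "('g, 'm) monoid_scheme"
    and T :: "'g topology"
    and X :: "'x topology"
    and \<phi> :: "'g \<Rightarrow> 'x \<Rightarrow> 'x"
    and t :: 'g
  assumes "topological_group G T"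
    and "\<not> amenable_on TYPE('y) G T"
    and "universal_minimal_strongly_proximal_flow G T X \<phi>"
    and "t \<in> carrier G"
    and "T closure_of (generate G ((\<lambda>a. a t) ` topological_auto G T)) = topspace T"
  shows "\<exists>x \<in> topspace X. \<phi> t x \<noteq> x"
proof (rule ccontr)
  assume "\<not> ?thesis"
  then have fix_t: "\<And>x. x \<in> topspace X \<Longrightarrow> \<phi> t x = x" by blast
  have msp: "minimal_strongly_proximal_flow G T X \<phi>"
    and univ: "\<And>(Y :: 'g set set topology) \<psi>. minimal_strongly_proximal_flow G T Y \<psi> \<Longrightarrow>
      \<exists>f. factor_map G X \<phi> Y \<psi> f"
    using assms(3) by (auto simp: universal_minimal_strongly_proximal_flow_def)
  interpret X: flow G T X \<phi> using msp by (simp add: minimal_strongly_proximal_flow_def)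
  let ?K = "{g \<in> carrier G. \<forall>x\<in>topspace X. \<phi> g x = x}"
  have "a t \<in> ?K" if a: "a \<in> topological_auto G T" for a
  proof -
    obtain Y :: "'g set set topology" and \<psi> e where Y: "minimal_strongly_proximal_flow G T Y \<psi>"
      and e: "homeomorphic_map X Y e" "factor_map G X (\<lambda>t. \<phi> (a t)) Y \<psi> e"
      using minimal_strongly_proximal_flow_copy[OF minimal_strongly_proximal_flow_twist[OF msp a]] by blast
    obtain f where f: "factor_map G X \<phi> Y \<psi> f" using univ[OF Y] by blast
    \<comment> \<open>The factor map \<open>f\<close> is onto and equivariant for the untwisted
      action, so the triviality of \<open>t\<close> on \<open>X\<close> descends to
      \<open>Y\<close>.\<close>
    have fix_Y: "\<psi> t y = y" if "y \<in> topspace Y" for y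
      using that f fix_t assms(4) unfolding factor_map_def by (metis imageE)
    have at: "a t \<in> carrier G"
      using a assms(4) by (auto simp: topological_auto_def auto_def hom_in_carrier)
    have "\<phi> (a t) x = x" if x: "x \<in> topspace X" for x
    proof -
      \<comment> \<open>\<open>e\<close> is equivariant for the twisted action: \<open>t\<close> on
        \<open>Y\<close> corresponds to \<open>a t\<close> on \<open>X\<close>. Injectivity of
        \<open>e\<close> then brings the fixed points back.\<close>
      have "e (\<phi> (a t) x) = \<psi> t (e x)" using e(2) assms(4) x by (simp add: factor_map_def)
      also have "\<dots> = e x" by (rule fix_Y) (use e(2) x in \<open>auto simp: factor_map_def\<close>)
      finally show ?thesis
        using homeomorphic_imp_injective_map[OF e(1)] X.action_in[OF at x] x by (simp add: inj_on_def)
    qed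
    then show ?thesis using at by blast
  qed
  then have "generate G ((\<lambda>a. a t) ` topological_auto G T) \<subseteq> ?K"
    by (intro X.generate_subgroup_incl[OF _ X.subgroup_kernel]) blast
  then have "T closure_of (generate G ((\<lambda>a. a t) ` topological_auto G T)) \<subseteq> ?K"
    by (rule closure_of_minimal[OF _ X.closedin_kernel])
  then have triv: "\<phi> g x = x" if "g \<in> carrier G" "x \<in> topspace X" for g x
    using that assms(5) X.topspace_eq_carrier by auto
  obtain x0 where x0: "x0 \<in> topspace X" using X.nonempty_space by blast
  have "orbit G \<phi> x0 = (\<lambda>g. \<phi> g x0) ` carrier G" by (auto simp: orbit_def)
  also have "\<dots> = (\<lambda>_. x0) ` carrier G" by (rule image_cong) (simp_all add: triv x0)
  also have "\<dots> = {x0}" using X.one_closed by auto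
  finally have "orbit G \<phi> x0 = {x0}" .
  moreover have "topspace X = X closure_of (orbit G \<phi> x0)"
    using msp x0 by (simp add: minimal_strongly_proximal_flow_def minimal_action_def)
  ultimately have X_single: "topspace X = {x0}"
    using closure_of_closedin[OF closedin_Hausdorff_singleton[OF X.Hausdorff_flow_space x0]] by simp
  obtain Y :: "'y topology" and \<psi> where Y: "flow G T Y \<psi>" "\<nexists>\<mu>. invariant_measure G Y \<psi> \<mu>"
    using assms(2) by (auto simp: amenable_on_def)
  interpret Y: flow G T Y \<psi> by (rule Y)
  obtain Z :: "(('y \<Rightarrow> real) \<Rightarrow> real) topology" and \<zeta>
    where Z: "minimal_strongly_proximal_flow G T Z \<zeta>" "\<nexists>z. topspace Z = {z}"
    using Y.nontrivial_minimal_strongly_proximal_flow[OF Y(2)] by blast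
  obtain W :: "'g set set topology" and \<omega> e
    where W: "minimal_strongly_proximal_flow G T W \<omega>" "homeomorphic_map Z W e"
    using minimal_strongly_proximal_flow_copy[OF Z(1)] by blast
  obtain f where "factor_map G X \<phi> W \<omega> f" using univ[OF W(1)] by blast
  \<comment> \<open>A factor of a one-point flow has one point, and so has \<open>Z\<close>, as
    \<open>e\<close> is injective.\<close>
  then have "topspace W = {f x0}" using X_single by (auto simp: factor_map_def)
  then have im: "e ` topspace Z = {f x0}" using homeomorphic_imp_surjective_map[OF W(2)] by simp
  then obtain z where z: "z \<in> topspace Z" by blast
  have "y = z" if y: "y \<in> topspace Z" for y
  proof (rule inj_onD[OF homeomorphic_imp_injective_map[OF W(2)] _ y z])
    have "e y \<in> {f x0}" "e z \<in> {f x0}" using y z im by blast+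
    then show "e y = e z" by simp
  qed
  then have "topspace Z = {z}" using z by blast
  then show False using Z(2) by blast
qed

end
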